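(* Let $X$ be a real Banach space, let $A$ be the generator of a $C_0$ semigroup on $X$ with domain $\mathcal{D}_A$, let $U,V$ be real Hilbert spaces, and let $B\in\mathcal{B}(U,X)$, $C\in\mathcal{B}(X,V)$. Suppose that $(A,B)$ is exponentially stabilizable and $(C,A)$ is exponentially detectable. Then: (i) The algebraic operator Riccati equation $$A^*P+PA-PBB^*P+C^*C=0$$ has a unique positive solution $P\in\mathcal{B}_s^+(X,X^* )$ such that $P(\mathcal{D}_A)\subseteq\mathcal{D}_{A^*}$ and $\|A^*P+PA\|<\infty$. This solution is stabilizing, i.e. $A-BB^*P$ generates an exponentially stable semigroup. (ii) There exists $P_0\in\mathcal{B}_s^+(X,X^* )$ such that $A-BB^*P_0$ generates an exponentially stable semigroup; for example, if $K\in\mathcal{B}(X,U)$ is such that $A-BK$ generates an exponentially stable semigroup, one may take $P_0$ to be a solution in $\mathcal{B}_s^+(X,X^* )$ (which exists) of the Lyapunov equation $$(A-BK)^*P_0+P_0(A-BK)=-C^*C-K^*K.$$ For any $P_0\in\mathcal{B}_s^+(X,X^* )$ such that $A-BB^*P_0$ generates an exponentially stable semigroup, the linear Lyapunov equations $$(A-BB^*P_n)^*P_{n+1}+P_{n+1}(A-BB^*P_n)=-C^*C-P_nBB^*P_n,\qquad n\ge0,$$ have solutions $P_{n+1}\in\mathcal{B}_s^+(X,X^* )$, the sequence $(P_n)_{n\ge1}$ is monotone, and it converges in the strong operator topology to the solution $P$ from (i). Moreover, there is $\varkappa>0$ such that $\|P-P_{n+1}\|\le\varkappa\|P-P_n\|^2$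 for all $n$.
   Context: $\mathcal{B}(X,Y)$ is the Banach space of bounded linear operators $X\to Y$ with the operator norm; $\langle\cdot,\cdot\rangle$ is the duality pairing between $X^*$ and $X$. An operator $P\in\mathcal{B}(X,X^* )$ is symmetric if $\langle Px,y\rangle=\langle Py,x\rangle$ for all $x,y\in X$, and positive definite (positive) if $\langle Px,x\rangle\ge 0$ for all $x\in X$ (non-strict). $\mathcal{B}_s(X,X^* )$ is the space of symmetric operators, $\mathcal{B}_s^+(X,X^* )$ the cone of symmetric positive definite ones, and $P\ge R$ means $P-R\in\mathcal{B}_s^+(X,X^* )$; monotonicity of sequences is with respect to this order. For a generator $G$, $G^*$ is the Banach space adjoint with domain $\mathcal{D}_{G^*}\subseteq X^*$. Hilbert spaces are identified with their duals, so $B^*\in\mathcal{B}(X^*,U)$, $BB^*\in\mathcal{B}(X^*,X)$, $C^*C\in\mathcal{B}_s^+(X,X^* )$, $K^*K\in\mathcal{B}_s^+(X,X^* )$. An operator $G^*P+PG$, defined on $\mathcal{D}_G$ when $P(\mathcal{D}_G)\subseteq\mathcal{D}_{G^*}$, is identified with its closure: when it is bounded on $\mathcal{D}_G$ (this is the meaning of $\|G^*P+PG\|<\infty$), it is extended to all of $X$. A solution of the Riccati equation or of a Lyapunov equation with generator $G$ is understood to satisfy $P(\mathcal{D}_G)\subseteq\mathcal{D}_{G^*}$, and the equation holds when applied to every $x\in\mathcal{D}_G$. (Here $G=A-BB^*P_n$ or $G=A-BK$ has $\mathcal{D}_G=\mathcal{D}_A$.) A semigroup $S(t)$ is exponentially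 stable if $\|S(t)\|\le Me^{-\varepsilon t}$ for all $t\ge0$ and some $M,\varepsilon>0$. The pair $(A,B)$ is exponentially stabilizable if there exists $K\in\mathcal{B}(X,U)$ such that $A-BK$ generates an exponentially stable $C_0$ semigroup. The pair $(C,A)$ is exponentially detectable if there exists $L\in\mathcal{B}(V,X)$ such that $A-LC$ generates an exponentially stable $C_0$ semigroup. Strong operator convergence $P_n\to P$ means $\|P_nx-Px\|\to0$ for every $x\in X$. *)

theory Defs
  imports "HOL-Analysis.Analysis"
begin

definition C0_semigroup :: "(real \<Rightarrow> 'x::banach \<Rightarrow>\<^sub>L 'x) \<Rightarrow> bool" where
  "C0_semigroup S \<longleftrightarrow>
     S 0 = id_blinfun \<and>
     (\<forall>s\<ge>0. \<forall>t\<ge>0. S (s + t) = S s o\<^sub>L S t) \<and>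
     (\<forall>x. ((\<lambda>t. S t x) \<longlongrightarrow> x) (at_right 0))"

definition exp_stable :: "(real \<Rightarrow> 'x::banach \<Rightarrow>\<^sub>L 'x) \<Rightarrow> bool" where
  "exp_stable S \<longleftrightarrow> (\<exists>M>0. \<exists>\<epsilon>>0. \<forall>t\<ge>0. norm (S t) \<le> M * exp (- \<epsilon> * t))"

text \<open>An unbounded operator is a domain \<open>D\<close> together with a total function \<open>A\<close> whose values
  outside \<open>D\<close> are irrelevant.\<close>

definition is_generator ::
    "(real \<Rightarrow> 'x::banach \<Rightarrow>\<^sub>L 'x) \<Rightarrow> 'x set \<Rightarrow> ('x \<Rightarrow> 'x) \<Rightarrow> bool" where
  "is_generator S D A \<longleftrightarrow>
     D = {x. \<exists>y. ((\<lambda>t. (S t x - x) /\<^sub>R t) \<longlongrightarrow> y) (at_right 0)} \<and>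
     (\<forall>x\<in>D. ((\<lambda>t. (S t x - x) /\<^sub>R t) \<longlongrightarrow> A x) (at_right 0))"

definition generates_C0 :: "'x::banach set \<Rightarrow> ('x \<Rightarrow> 'x) \<Rightarrow> bool" where
  "generates_C0 D A \<longleftrightarrow> (\<exists>S. C0_semigroup S \<and> is_generator S D A)"

definition generates_exp_stable :: "'x::banach set \<Rightarrow> ('x \<Rightarrow> 'x) \<Rightarrow> bool" where
  "generates_exp_stable D A \<longleftrightarrow> (\<exists>S. C0_semigroup S \<and> is_generator S D A \<and> exp_stable S)"

definition adj_dom :: "'x::banach set \<Rightarrow> ('x \<Rightarrow> 'x) \<Rightarrow> ('x \<Rightarrow>\<^sub>L real) set" where
  "adj_dom D G = {\<phi> :: 'x \<Rightarrow>\<^sub>L real. \<exists>\<psi>::'x \<Rightarrow>\<^sub>L real. \<forall>x\<in>D. \<phi> (G x) = \<psi> x}"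

text \<open>The functional below is unique when \<open>D\<close> is dense, as it is for generators.\<close>

definition adj_op :: "'x::banach set \<Rightarrow> ('x \<Rightarrow> 'x) \<Rightarrow> ('x \<Rightarrow>\<^sub>L real) \<Rightarrow> ('x \<Rightarrow>\<^sub>L real)" where
  "adj_op D G \<phi> = (THE \<psi>::'x \<Rightarrow>\<^sub>L real. \<forall>x\<in>D. \<phi> (G x) = \<psi> x)"

text \<open>A Hilbert space \<open>H\<close> is identified with its dual through \<open>h \<mapsto> \<langle>h, \<cdot>\<rangle>\<close>
  (\<open>blinfun_inner_right\<close>); \<open>riesz_rep\<close> is the inverse of this identification, total by
  completeness (Riesz).\<close>

definition riesz_rep :: "('h::{real_inner,banach} \<Rightarrow>\<^sub>L real) \<Rightarrow> 'h" where
  "riesz_rep \<phi> = (THE h. blinfun_inner_right h = \<phi>)"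

text \<open>\<open>T\<^sup>* \<in> B(X\<^sup>*, H)\<close> for \<open>T \<in> B(H, X)\<close>, and \<open>T\<^sup>* \<in> B(H, X\<^sup>*)\<close> for \<open>T \<in> B(X, H)\<close>.\<close>

definition adj_from :: "('h::{real_inner,banach} \<Rightarrow>\<^sub>L 'x::banach) \<Rightarrow> ('x \<Rightarrow>\<^sub>L real) \<Rightarrow> 'h" where
  "adj_from T \<phi> = riesz_rep (\<phi> o\<^sub>L T)"

definition adj_to :: "('x::banach \<Rightarrow>\<^sub>L 'h::{real_inner,banach}) \<Rightarrow> 'h \<Rightarrow> ('x \<Rightarrow>\<^sub>L real)" where
  "adj_to T h = blinfun_inner_right h o\<^sub>L T"

definition Bs_pos :: "('x::banach \<Rightarrow>\<^sub>L 'x \<Rightarrow>\<^sub>L real) set" where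
  "Bs_pos = {P :: 'x \<Rightarrow>\<^sub>L 'x \<Rightarrow>\<^sub>L real. (\<forall>x y. P x y = P y x) \<and> (\<forall>x. P x x \<ge> 0)}"

definition op_le :: "('x::banach \<Rightarrow>\<^sub>L 'x \<Rightarrow>\<^sub>L real) \<Rightarrow> ('x \<Rightarrow>\<^sub>L 'x \<Rightarrow>\<^sub>L real) \<Rightarrow> bool" where
  "op_le R P \<longleftrightarrow> P - R \<in> Bs_pos"

definition feedback ::
    "('x::banach \<Rightarrow> 'x) \<Rightarrow> ('u::{real_inner,banach} \<Rightarrow>\<^sub>L 'x) \<Rightarrow> ('x \<Rightarrow>\<^sub>L 'u) \<Rightarrow> 'x \<Rightarrow> 'x" where
  "feedback A B K = (\<lambda>x. A x - B (K x))"

definition exp_stabilizable ::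
    "'x::banach set \<Rightarrow> ('x \<Rightarrow> 'x) \<Rightarrow> ('u::{real_inner,banach} \<Rightarrow>\<^sub>L 'x) \<Rightarrow> bool" where
  "exp_stabilizable D A B \<longleftrightarrow>
     (\<exists>K :: 'x \<Rightarrow>\<^sub>L 'u. generates_exp_stable D (feedback A B K))"

definition exp_detectable ::
    "('x::banach \<Rightarrow>\<^sub>L 'v::{real_inner,banach}) \<Rightarrow> 'x set \<Rightarrow> ('x \<Rightarrow> 'x) \<Rightarrow> bool" where
  "exp_detectable C D A \<longleftrightarrow>
     (\<exists>L :: 'v \<Rightarrow>\<^sub>L 'x. generates_exp_stable D (\<lambda>x. A x - L (C x)))"

definition closed_loop ::
    "('x::banach \<Rightarrow> 'x) \<Rightarrow> ('u::{real_inner,banach} \<Rightarrow>\<^sub>L 'x) \<Rightarrow> ('x \<Rightarrow>\<^sub>L 'x \<Rightarrow>\<^sub>L real) \<Rightarrow> 'x \<Rightarrow> 'x" where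
  "closed_loop A B P = (\<lambda>x. A x - B (adj_from B (P x)))"

definition maps_dom :: "'x::banach set \<Rightarrow> ('x \<Rightarrow> 'x) \<Rightarrow> ('x \<Rightarrow>\<^sub>L 'x \<Rightarrow>\<^sub>L real) \<Rightarrow> bool" where
  "maps_dom D G P \<longleftrightarrow> blinfun_apply P ` D \<subseteq> adj_dom D G"

text \<open>\<open>G\<^sup>*P + PG\<close>, meaningful on \<open>D\<close> when \<open>maps_dom D G P\<close>.\<close>

definition lyap :: "'x::banach set \<Rightarrow> ('x \<Rightarrow> 'x) \<Rightarrow> ('x \<Rightarrow>\<^sub>L 'x \<Rightarrow>\<^sub>L real) \<Rightarrow> 'x \<Rightarrow> ('x \<Rightarrow>\<^sub>L real)" where
  "lyap D G P x = adj_op D G (P x) + P (G x)"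

definition lyapunov_solution ::
    "'x::banach set \<Rightarrow> ('x \<Rightarrow> 'x) \<Rightarrow> ('x \<Rightarrow> ('x \<Rightarrow>\<^sub>L real)) \<Rightarrow> ('x \<Rightarrow>\<^sub>L 'x \<Rightarrow>\<^sub>L real) \<Rightarrow> bool" where
  "lyapunov_solution D G Q P \<longleftrightarrow> maps_dom D G P \<and> (\<forall>x\<in>D. lyap D G P x = Q x)"

definition riccati_solution ::
    "'x::banach set \<Rightarrow> ('x \<Rightarrow> 'x) \<Rightarrow> ('u::{real_inner,banach} \<Rightarrow>\<^sub>L 'x)
      \<Rightarrow> ('x \<Rightarrow>\<^sub>L 'v::{real_inner,banach}) \<Rightarrow> ('x \<Rightarrow>\<^sub>L 'x \<Rightarrow>\<^sub>L real) \<Rightarrow> bool" where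
  "riccati_solution D A B C P \<longleftrightarrow>
     maps_dom D A P \<and>
     (\<exists>M. \<forall>x\<in>D. norm (lyap D A P x) \<le> M * norm x) \<and>
     (\<forall>x\<in>D. lyap D A P x - P (B (adj_from B (P x))) + adj_to C (C x) = 0)"

text \<open>The initial guess \<open>Q 0\<close> is not constrained here.\<close>

definition newton_kleinman ::
    "'x::banach set \<Rightarrow> ('x \<Rightarrow> 'x) \<Rightarrow> ('u::{real_inner,banach} \<Rightarrow>\<^sub>L 'x)
      \<Rightarrow> ('x \<Rightarrow>\<^sub>L 'v::{real_inner,banach}) \<Rightarrow> (nat \<Rightarrow> 'x \<Rightarrow>\<^sub>L 'x \<Rightarrow>\<^sub>L real) \<Rightarrow> bool" where
  "newton_kleinman D A B C Q \<longleftrightarrow>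
     (\<forall>n. Q (Suc n) \<in> Bs_pos \<and>
          lyapunov_solution D (closed_loop A B (Q n))
            (\<lambda>x. - adj_to C (C x) - Q n (B (adj_from B (Q n x)))) (Q (Suc n)))"

end

theory Submission
  imports Defs
begin

text \<open>
  Write \<open>A\<^sub>F = A - BF\<close>, let \<open>R\<close> solve the Lyapunov equation
  \<open>A\<^sub>F\<^sup>*R + RA\<^sub>F = - C\<^sup>*C - F\<^sup>*F\<close> and put \<open>F' = B\<^sup>*R\<close>. Completing squares gives
  \<open>A\<^sub>F\<^sub>'\<^sup>*R + RA\<^sub>F\<^sub>' = - C\<^sup>*C - F'\<^sup>*F' - (F - F')\<^sup>*(F - F')\<close>. Hence \<open>Cx(t)\<close> and \<open>F'x(t)\<close> are
  square integrable along the orbits of \<open>A\<^sub>F\<^sub>'\<close>; regarding \<open>A\<^sub>F\<^sub>'\<close> as a bounded perturbation of the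
  exponentially stable \<open>A - LC\<close>, the variation of constants formula makes \<open>x(t)\<close> itself square
  integrable, and \<open>A\<^sub>F\<^sub>'\<close> is exponentially stable by Datko's theorem, with an \<open>L\<^sup>2\<close> bound that
  depends only on \<open>\<parallel>R\<parallel>\<close>.

  Comparing Lyapunov equations with the same generator, the iterates decrease, so they converge
  strongly, and the limit solves the Riccati equation. For a Riccati solution \<open>P\<close>,
  \<open>A\<^sub>F\<^sup>*(R - P) + (R - P)A\<^sub>F = - (F - B\<^sup>*P)\<^sup>*(F - B\<^sup>*P)\<close>; this gives \<open>P \<le> R\<close>, hence
  uniqueness, and with \<open>F = B\<^sup>*P\<^sub>n\<close> the quadratic rate.
\<close>

section \<open>Duality and symmetric operators\<close>

text \<open>The form of \<open>R\<close> is only nonnegative, so a decreasing energy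
  \<open>R x(t) x(t)\<close> does not control the norm of \<open>x(t)\<close>; this is why stability
  passes through the detectability operator \<open>L\<close>. For the feedback produced by a step,
  the L2 bound uses the growth constants of the one fixed semigroup of \<open>A - LC\<close>, never
  those of the closed loop, which makes it uniform over the iterates. Lyapunov and Riccati equations
  are both reduced to bilinear identities on \<open>D\<close>. The adjoint disappears, and the
  condition on its domain holds automatically because the right-hand side is a bounded functional.
  The equation for \<open>K\<close>, the iteration and the Riccati equation then become instances of
  one predicate \<open>kleinman_step\<close>, which sees the previous iterate only through its
  feedback. The Riccati solution is itself obtained from the iteration, started at the cost of a
  stabilizing \<open>K\<close>. A general initial guess need not solve any equation, so its closed
  loop gets its own L2 constant and monotonicity starts at index 1.\<close>

lemma riesz_representation:
  fixes \<phi> :: "'h::{real_inner,banach} \<Rightarrow>\<^sub>L real"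
  shows "\<exists>!h. blinfun_inner_right h = \<phi>"
proof -
  \<comment> \<open>Riesz by the direct method: the parallelogram law makes a minimizing sequence of
    the energy \<open>J\<close> Cauchy, and the first variation at its limit yields the
    representation.\<close>
  define J where "J h = inner h h / 2 - \<phi> h" for h
  have lower: "- (norm \<phi>)\<^sup>2 / 2 \<le> J h" for h
  proof -
    have "\<phi> h \<le> norm \<phi> * norm h"
      using norm_blinfun[of \<phi> h] by simp
    moreover have "0 \<le> (norm h - norm \<phi>)\<^sup>2" by simp
    ultimately show ?thesis
      by (simp add: J_def power2_norm_eq_inner[symmetric] power2_eq_square algebra_simps)
  qed
  define m where "m = Inf (range J)"
  have bdd: "bdd_below (range J)" using lower by (auto intro!: bdd_belowI)
  have m_le: "m \<le> J h" for h
    unfolding m_def by (intro cInf_lower bdd) auto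
  have "\<exists>h. J h < m + 1 / Suc n" for n
  proof -
    have "Inf (range J) < m + 1 / Suc n" by (simp add: m_def)
    then show ?thesis using cInf_less_iff[OF _ bdd] by auto
  qed
  then obtain x where x: "\<And>n. J (x n) < m + 1 / Suc n" by metis
  have par: "(norm (a - b))\<^sup>2 / 4 = J a + J b - 2 * J ((a + b) /\<^sub>R 2)" for a b
    by (simp add: J_def power2_norm_eq_inner algebra_simps blinfun.add_right blinfun.scaleR_right
        inner_commute) (simp add: field_simps)
  have est: "(norm (x i - x j))\<^sup>2 \<le> 4 * (1 / Suc i + 1 / Suc j)" for i j
  proof -
    have "n \<le> 4 * (u + v)"
      if "n / 4 = a + b - 2 * c" "a < m + u" "b < m + v" "m \<le> c" for n a b c u v :: real
      using that by (simp add: field_simps)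
    from this[OF par x x m_le] show ?thesis .
  qed
  have "Cauchy x"
  proof (rule metric_CauchyI)
    fix e :: real assume "0 < e"
    then obtain N where N: "8 / e\<^sup>2 < real N" using reals_Archimedean2 by blast
    have "dist (x i) (x j) < e" if "i \<ge> N" "j \<ge> N" for i j
    proof -
      have "0 < real N" using N \<open>0 < e\<close> by (smt (verit) divide_nonneg_nonneg zero_le_power2)
      have "1 / Suc i < 1 / real N" "1 / Suc j < 1 / real N"
        using that \<open>0 < real N\<close> by (auto intro!: divide_strict_left_mono)
      with est[of i j] have "(norm (x i - x j))\<^sup>2 < 8 / real N" by simp
      also have "\<dots> < e\<^sup>2" using N \<open>0 < e\<close> \<open>0 < real N\<close> by (simp add: field_simps)
      finally show ?thesis using \<open>0 < e\<close> by (simp add: dist_norm power2_less_imp_less)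
    qed
    then show "\<exists>M. \<forall>m\<ge>M. \<forall>n\<ge>M. dist (x m) (x n) < e" by blast
  qed
  then obtain h where h: "x \<longlonglongrightarrow> h" using convergent_eq_Cauchy by blast
  have "(\<lambda>n. J (x n)) \<longlonglongrightarrow> J h"
    unfolding J_def by (intro tendsto_intros h) simp
  moreover have "(\<lambda>n. m + 1 / Suc n) \<longlonglongrightarrow> m + 0"
    by (intro tendsto_intros LIMSEQ_inverse_real_of_nat[unfolded inverse_eq_divide])
  ultimately have Jh: "J h \<le> m + 0"
    by (rule LIMSEQ_le) (use x less_imp_le in blast)
  have "inner h y = \<phi> y" for y
  proof -
    define d where "d = inner h y - \<phi> y"
    \<comment> \<open>Up to the \<open>+ 1\<close>, which keeps the denominator positive for
      \<open>y = 0\<close>, this minimizes \<open>t * d + t\<^sup>2 * inner y y / 2\<close>.\<close>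
    define t where "t = - d / (inner y y + 1)"
    have pos: "0 < inner y y + 1" by (smt (verit) inner_ge_zero)
    have "J h \<le> J (h + t *\<^sub>R y)" using Jh m_le[of "h + t *\<^sub>R y"] by simp
    then have "0 \<le> t * d + t\<^sup>2 * inner y y / 2"
      by (simp add: J_def d_def algebra_simps blinfun.add_right blinfun.scaleR_right
          inner_commute power2_eq_square)
    also have "t * d = - (d\<^sup>2 / (inner y y + 1))"
      by (simp add: t_def power2_eq_square)
    also have "t\<^sup>2 * inner y y / 2 \<le> d\<^sup>2 / (inner y y + 1) / 2"
    proof -
      have "t\<^sup>2 * inner y y \<le> t\<^sup>2 * (inner y y + 1)" by (simp add: mult_left_mono)
      also have "\<dots> = d\<^sup>2 / (inner y y + 1)"
        using pos by (simp add: t_def power2_eq_square)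
      finally show ?thesis by (rule divide_right_mono) simp
    qed
    finally have *: "0 \<le> - (d\<^sup>2 / (inner y y + 1)) + d\<^sup>2 / (inner y y + 1) / 2" by simp
    have "z \<le> 0" if "0 \<le> - z + z / 2" for z :: real using that by simp
    from this[OF *] have "d\<^sup>2 / (inner y y + 1) \<le> 0" .
    then have "d\<^sup>2 \<le> 0" using pos by (simp add: divide_le_0_iff)
    then show ?thesis by (simp add: d_def)
  qed
  then have "blinfun_inner_right h = \<phi>" by (auto intro!: blinfun_eqI)
  moreover have "h' = h" if "blinfun_inner_right h' = blinfun_inner_right h" for h' :: 'h
    using that by (metis blinfun_inner_right.rep_eq vector_eq_rdot)
  ultimately show ?thesis by metis
qed

lemma inner_riesz_rep: "inner (riesz_rep \<phi>) u = \<phi> u"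
  using theI'[OF riesz_representation[of \<phi>]] unfolding riesz_rep_def
  by (metis blinfun_inner_right.rep_eq)

lemma inner_adj_from: "inner (adj_from T \<phi>) u = \<phi> (T u)"
  by (simp add: adj_from_def inner_riesz_rep)

text \<open>Evaluate the functional at its own representer and cancel one factor of the
  norm.\<close>

lemma norm_adj_from_le: "norm (adj_from T \<phi>) \<le> norm T * norm \<phi>"
proof -
  let ?h = "adj_from T \<phi>"
  have "norm ?h * norm ?h = \<phi> (T ?h)"
    by (metis inner_adj_from power2_norm_eq_inner power2_eq_square)
  also have "\<dots> \<le> norm \<phi> * (norm T * norm ?h)"
    by (smt (verit) norm_blinfun mult_left_mono norm_ge_zero real_norm_def)
  finally have "norm ?h * norm ?h \<le> (norm T * norm \<phi>) * norm ?h" by (simp add: ac_simps)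
  then show ?thesis
    by (metis mult_right_le_imp_le norm_ge_zero order_le_less zero_le_mult_iff)
qed

lemma bounded_linear_adj_from: "bounded_linear (adj_from T)"
proof (rule bounded_linear_intro[where K = "norm T"])
  show "adj_from T (x + y) = adj_from T x + adj_from T y" for x y
    by (rule vector_eq_rdot[THEN iffD1])
      (simp add: inner_adj_from inner_add_left blinfun.add_left)
  show "adj_from T (r *\<^sub>R x) = r *\<^sub>R adj_from T x" for r x
    by (rule vector_eq_rdot[THEN iffD1])
      (simp add: inner_adj_from blinfun.scaleR_left)
  show "norm (adj_from T x) \<le> norm x * norm T" for x
    using norm_adj_from_le[of T x] by (simp add: mult.commute)
qed

text \<open>The feedback \<open>B\<^sup>*P\<close>, packaged as a bounded operator so that closed
  loops become instances of \<open>feedback\<close>.\<close>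

definition gain ::
    "('u::{real_inner,banach} \<Rightarrow>\<^sub>L 'x::banach) \<Rightarrow> ('x \<Rightarrow>\<^sub>L 'x \<Rightarrow>\<^sub>L real) \<Rightarrow> 'x \<Rightarrow>\<^sub>L 'u" where
  "gain B P = Blinfun (adj_from B) o\<^sub>L P"

lemma gain_apply: "gain B P x = adj_from B (P x)"
  by (simp add: gain_def bounded_linear_Blinfun_apply bounded_linear_adj_from)

lemma inner_gain: "inner (gain B P x) u = P x (B u)"
  by (simp add: gain_apply inner_adj_from)

lemma norm_gain_le: "norm (gain B P x) \<le> norm B * norm (P x)"
  by (simp add: gain_apply norm_adj_from_le)

lemma gain_diff: "gain B (P - Q) x = gain B P x - gain B Q x"
  by (simp add: gain_apply blinfun.diff_left bounded_linear.linear[OF bounded_linear_adj_from]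
      linear_diff)

lemma closed_loop_eq_feedback: "closed_loop A B P = feedback A B (gain B P)"
  by (simp add: closed_loop_def feedback_def gain_apply)

lemma adj_to_apply: "adj_to T h x = inner h (T x)"
  by (simp add: adj_to_def)

lemma adj_from_quadratic:
  fixes P :: "'x::banach \<Rightarrow>\<^sub>L 'x \<Rightarrow>\<^sub>L real"
  assumes "\<And>x y. P x y = P y x"
  shows "P (B (adj_from B (P x))) y = inner (gain B P x) (gain B P y)"
  by (simp add: assms[of _ y] inner_gain[symmetric] gain_apply inner_commute)

section \<open>Order and norm of symmetric nonnegative forms\<close>

lemma Bs_pos_sym: "P \<in> Bs_pos \<Longrightarrow> P x y = P y x"
  and Bs_pos_nonneg: "P \<in> Bs_pos \<Longrightarrow> 0 \<le> P x x"
  by (auto simp: Bs_pos_def)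

lemma Bs_pos_Cauchy_Schwarz:
  assumes "R \<in> Bs_pos"
  shows "(R x y)\<^sup>2 \<le> R x x * R y y"
proof -
  have quad: "0 \<le> R x x + 2 * t * R x y + t\<^sup>2 * R y y" for t
    using Bs_pos_nonneg[OF assms, of "x + t *\<^sub>R y"] Bs_pos_sym[OF assms, of y x]
    by (simp add: blinfun.add_right blinfun.add_left blinfun.scaleR_right blinfun.scaleR_left
        algebra_simps power2_eq_square)
  show ?thesis
  proof (cases "R y y = 0")
    case True
    have "R x y = 0"
    proof (rule ccontr)
      assume "R x y \<noteq> 0"
      \<comment> \<open>With \<open>R y y = 0\<close> the quadratic is affine in \<open>t\<close>,
        and this \<open>t\<close> gives it the value \<open>- 1\<close>.\<close>
      then show False using quad[of "- (R x x + 1) / (2 * R x y)"] True by (simp add: field_simps)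
    qed
    then show ?thesis using True by simp
  next
    case False
    then have "0 < R y y" using Bs_pos_nonneg[OF assms, of y] by simp
    then show ?thesis
      using quad[of "- R x y / R y y"] by (simp add: power2_eq_square field_simps)
  qed
qed

text \<open>Cauchy-Schwarz for the form passes from the diagonal to all pairs \<open>x\<close>,
  \<open>y\<close> without losing a factor in \<open>k\<close>.\<close>

lemma Bs_pos_norm_le:
  assumes R: "R \<in> Bs_pos" and "0 \<le> k" and le: "\<And>x. R x x \<le> k * (norm x)\<^sup>2"
  shows "norm R \<le> k"
proof (rule norm_blinfun_bound[OF \<open>0 \<le> k\<close>], rule norm_blinfun_bound)
  show "0 \<le> k * norm x" for x using \<open>0 \<le> k\<close> by simp
  fix x y
  have "(R x y)\<^sup>2 \<le> R x x * R y y" by (rule Bs_pos_Cauchy_Schwarz[OF R])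
  also have "\<dots> \<le> (k * (norm x)\<^sup>2) * (k * (norm y)\<^sup>2)"
    using \<open>0 \<le> k\<close> by (intro mult_mono le Bs_pos_nonneg[OF R]) auto
  also have "\<dots> = (k * norm x * norm y)\<^sup>2" by (simp add: power2_eq_square)
  finally have "\<bar>R x y\<bar> \<le> \<bar>k * norm x * norm y\<bar>" by (simp add: abs_le_square_iff)
  then show "norm (R x y) \<le> k * norm x * norm y" using \<open>0 \<le> k\<close> by simp
qed

lemma form_le: "R x x \<le> norm R * (norm x)\<^sup>2" for R :: "'x::banach \<Rightarrow>\<^sub>L 'x \<Rightarrow>\<^sub>L real"
proof -
  have "R x x \<le> norm (R x) * norm x" using norm_blinfun[of "R x" x] by simp
  also have "\<dots> \<le> (norm R * norm x) * norm x"
    by (intro mult_right_mono norm_blinfun) simp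
  finally show ?thesis by (simp add: power2_eq_square ac_simps)
qed

text \<open>Applied to a difference of two iterates, this turns convergence of the scalars
  \<open>Q n x x\<close> into norm convergence of the functionals \<open>Q n x\<close>.\<close>

lemma Bs_pos_norm_apply:
  assumes R: "R \<in> Bs_pos"
  shows "(norm (R x))\<^sup>2 \<le> norm R * R x x"
proof -
  have "norm (R x) \<le> sqrt (norm R * R x x)"
  proof (rule norm_blinfun_bound)
    show "0 \<le> sqrt (norm R * R x x)" using Bs_pos_nonneg[OF R, of x] by simp
    fix y
    have "(R x y)\<^sup>2 \<le> R x x * (norm R * (norm y)\<^sup>2)"
      using Bs_pos_Cauchy_Schwarz[OF R, of x y] form_le[of R y] Bs_pos_nonneg[OF R, of x]
      by (smt (verit) mult_left_mono)
    then have "(R x y)\<^sup>2 \<le> norm R * R x x * (norm y)\<^sup>2"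
      by (simp add: ac_simps)
    then have "sqrt ((R x y)\<^sup>2) \<le> sqrt (norm R * R x x * (norm y)\<^sup>2)"
      by (rule real_sqrt_le_mono)
    then show "norm (R x y) \<le> sqrt (norm R * R x x) * norm y"
      by (simp add: real_sqrt_mult)
  qed
  then have "(norm (R x))\<^sup>2 \<le> (sqrt (norm R * R x x))\<^sup>2" by (simp add: power_mono)
  then show ?thesis using Bs_pos_nonneg[OF R, of x] by simp
qed

lemma op_le_iff:
  assumes "R \<in> Bs_pos" "P \<in> Bs_pos"
  shows "op_le R P \<longleftrightarrow> (\<forall>x. R x x \<le> P x x)"
  using assms by (auto simp: op_le_def Bs_pos_def blinfun.diff_left)

lemma Bs_pos_eqI:
  assumes "R \<in> Bs_pos" "P \<in> Bs_pos" "\<And>x. R x x = P x x"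
  shows "R = P"
proof -
  have "P - R \<in> Bs_pos"
    using op_le_iff[OF assms(1,2)] assms(3) by (simp add: op_le_def)
  then have "norm (P - R) \<le> 0"
    by (rule Bs_pos_norm_le) (simp_all add: blinfun.diff_left assms(3))
  then show ?thesis by simp
qed


section \<open>Strongly continuous semigroups\<close>

lemma has_vector_derivative_slope:
  fixes f :: "real \<Rightarrow> 'a::real_normed_vector"
  shows "(f has_vector_derivative y) (at t within A) \<longleftrightarrow>
    ((\<lambda>s. (f s - f t) /\<^sub>R (s - t)) \<longlongrightarrow> y) (at t within A)"
proof -
  have "norm ((f s - f t) /\<^sub>R (s - t) - y) = norm ((f s - f t - (s - t) *\<^sub>R y) /\<^sub>R norm (s - t))"
    if "s \<noteq> t" for s
  proof -
    have "(f s - f t) /\<^sub>R (s - t) - y = (f s - f t - (s - t) *\<^sub>R y) /\<^sub>R (s - t)"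
      using that by (simp add: scaleR_diff_right)
    then show ?thesis by simp
  qed
  then have "((\<lambda>s. norm ((f s - f t) /\<^sub>R (s - t) - y)) \<longlongrightarrow> 0) (at t within A) \<longleftrightarrow>
      ((\<lambda>s. norm ((f s - f t - (s - t) *\<^sub>R y) /\<^sub>R norm (s - t))) \<longlongrightarrow> 0) (at t within A)"
    by (intro filterlim_cong refl) (auto simp: eventually_at_filter)
  then show ?thesis
    unfolding has_vector_derivative_def has_derivative_at_within
    by (simp only: bounded_linear_scaleR_left tendsto_norm_zero_iff LIM_zero_iff simp_thms)
qed

lemma right_difference_quotient:
  fixes f :: "real \<Rightarrow> 'a::real_normed_vector"
  assumes "(f has_vector_derivative y) (at t within {t..u})" "t < u"
  shows "((\<lambda>h. (f (t + h) - f t) /\<^sub>R h) \<longlongrightarrow> y) (at_right 0)"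
  using assms(1) unfolding has_vector_derivative_slope at_within_Icc_at_right[OF assms(2)]
  by (simp add: filterlim_at_right_to_0[of _ _ t] add.commute)

text \<open>The growth bound is a parameter so that exponential stability reads \<open>w < 0\<close>
  and the estimates can track the explicit constants \<open>M\<close> and \<open>w\<close>.\<close>

locale growth_semigroup =
  fixes S :: "real \<Rightarrow> 'x::banach \<Rightarrow>\<^sub>L 'x" and D :: "'x set" and G :: "'x \<Rightarrow> 'x"
    and M w :: real
  assumes C0: "C0_semigroup S"
    and gen: "is_generator S D G"
    and growth: "\<And>t. 0 \<le> t \<Longrightarrow> norm (S t) \<le> M * exp (w * t)"
begin

lemma S_0 [simp]: "S 0 x = x"
  using C0 by (simp add: C0_semigroup_def)

lemma S_add: "0 \<le> s \<Longrightarrow> 0 \<le> t \<Longrightarrow> S (s + t) x = S s (S t x)"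
  using C0 by (simp add: C0_semigroup_def)

lemma M_nonneg: "0 \<le> M"
  using order_trans[OF norm_ge_zero growth[of 0]] by simp

lemma growth_apply: "0 \<le> t \<Longrightarrow> norm (S t x) \<le> M * exp (w * t) * norm x"
  by (rule order_trans[OF norm_blinfun mult_right_mono[OF growth]]) simp_all

lemma local_bound:
  assumes "0 \<le> t" "t \<le> \<tau>"
  shows "norm (S t x) \<le> M * exp (\<bar>w\<bar> * \<tau>) * norm x"
proof -
  have "w * t \<le> \<bar>w\<bar> * \<tau>"
    using assms by (intro mult_mono) auto
  then have "M * exp (w * t) * norm x \<le> M * exp (\<bar>w\<bar> * \<tau>) * norm x"
    by (intro mult_right_mono mult_left_mono M_nonneg) simp_all
  then show ?thesis
    using growth_apply[OF assms(1), of x] by simp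
qed

lemma continuous_orbit: "continuous_on {0..} (\<lambda>t. S t x)"
  unfolding continuous_on_iff
proof (intro ballI allI impI)
  fix t e :: real assume t: "t \<in> {0..}" and "0 < e"
  define K where "K = M * exp (\<bar>w\<bar> * (t + 1)) + 1"
  have "0 < K" using M_nonneg by (simp add: K_def add_nonneg_pos)
  have "((\<lambda>h. S h x) \<longlongrightarrow> x) (at_right 0)" using C0 by (simp add: C0_semigroup_def)
  then have "\<forall>\<^sub>F h in at_right 0. dist (S h x) x < e / K"
    by (rule tendstoD) (use \<open>0 < e\<close> \<open>0 < K\<close> in simp)
  then obtain d where "0 < d" and d: "\<And>h. 0 < h \<Longrightarrow> h < d \<Longrightarrow> dist (S h x) x < e / K"
    by (auto simp: eventually_at_right_field)
  have key: "dist (S (r + h) x) (S r x) < e" if "0 \<le> r" "r \<le> t + 1" "0 \<le> h" "h < d" for r h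
  proof (cases "h = 0")
    case False
    then have "dist (S (r + h) x) (S r x) = norm (S r (S h x - x))"
      using that by (simp add: S_add dist_norm blinfun.diff_right)
    also have "\<dots> \<le> K * norm (S h x - x)"
      using local_bound[OF that(1,2), of "S h x - x"]
      by (rule order_trans) (simp add: K_def mult_right_mono)
    also have "\<dots> < K * (e / K)"
      using d[of h] that False \<open>0 < K\<close> by (intro mult_strict_left_mono) (simp_all add: dist_norm)
    finally show ?thesis using \<open>0 < K\<close> by simp
  qed (use \<open>0 < e\<close> in simp)
  have "dist (S s x) (S t x) < e" if "s \<in> {0..}" "dist s t < min d 1" for s
  proof (cases "s \<le> t")
    case True
    then show ?thesis using key[of s "t - s"] that t by (simp add: dist_commute dist_real_def)
  next
    case False
    then show ?thesis using key[of t "s - t"] that t by (simp add: dist_real_def)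
  qed
  then show "\<exists>d>0. \<forall>x'\<in>{0..}. dist x' t < d \<longrightarrow> dist (S x' x) (S t x) < e"
    using \<open>0 < d\<close> by (intro exI[of _ "min d 1"]) simp
qed

text \<open>Joint continuity in time and vector: the local growth bound absorbs
  \<open>f z - f0\<close>, and strong continuity treats the fixed vector \<open>f0\<close>.\<close>

lemma tendsto_orbit:
  assumes a: "(a \<longlongrightarrow> a0) F" and nn: "\<forall>\<^sub>F z in F. 0 \<le> a z" "0 \<le> a0"
    and f: "(f \<longlongrightarrow> f0) F"
  shows "((\<lambda>z. S (a z) (f z)) \<longlongrightarrow> S a0 f0) F"
proof -
  define K where "K = M * exp (\<bar>w\<bar> * (a0 + 1))"
  have "\<forall>\<^sub>F z in F. a z < a0 + 1" using a by (rule order_tendstoD) simp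
  with nn(1) have "\<forall>\<^sub>F z in F. norm (S (a z) (f z - f0)) \<le> K * norm (f z - f0)"
    by eventually_elim (simp add: K_def local_bound)
  moreover have "((\<lambda>z. K * norm (f z - f0)) \<longlongrightarrow> 0) F"
    by (intro tendsto_mult_right_zero tendsto_norm_zero) (use f in \<open>simp add: LIM_zero_iff\<close>)
  ultimately have 1: "((\<lambda>z. S (a z) (f z - f0)) \<longlongrightarrow> 0) F"
    by (rule Lim_null_comparison)
  have 2: "((\<lambda>z. S (a z) f0) \<longlongrightarrow> S a0 f0) F"
    by (rule continuous_on_tendsto_compose[OF continuous_orbit a]) (use nn in auto)
  show ?thesis
    using tendsto_add[OF 1 2] by (simp add: blinfun.diff_right)
qed

lemma continuous_on_orbit:
  assumes "continuous_on X a" "\<And>z. z \<in> X \<Longrightarrow> 0 \<le> a z" "continuous_on X f"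
  shows "continuous_on X (\<lambda>z. S (a z) (f z))"
  using assms unfolding continuous_on_def
  by (auto intro!: tendsto_orbit simp: eventually_at_filter)

lemma generator_limit: "x \<in> D \<Longrightarrow> ((\<lambda>h. (S h x - x) /\<^sub>R h) \<longlongrightarrow> G x) (at_right 0)"
  using gen by (simp add: is_generator_def)

lemma generator_limitD:
  assumes "((\<lambda>h. (S h x - x) /\<^sub>R h) \<longlongrightarrow> y) (at_right 0)"
  shows "x \<in> D" "G x = y"
proof -
  show "x \<in> D" using gen assms by (auto simp: is_generator_def)
  from tendsto_unique[OF _ generator_limit[OF this] assms] show "G x = y" by simp
qed

lemma orbit_domain:
  assumes "x \<in> D" "0 \<le> t"
  shows "S t x \<in> D" "G (S t x) = S t (G x)"
proof -
  have "((\<lambda>h. S t ((S h x - x) /\<^sub>R h)) \<longlongrightarrow> S t (G x)) (at_right 0)"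
    by (rule blinfun.tendsto[OF tendsto_const generator_limit[OF assms(1)]])
  moreover have "\<forall>\<^sub>F h in at_right 0. S t ((S h x - x) /\<^sub>R h) = (S h (S t x) - S t x) /\<^sub>R h"
  proof (rule eventually_mono[OF eventually_at_right_less[of 0]])
    fix h :: real assume "0 < h"
    then have "S t (S h x) = S h (S t x)"
      using S_add[OF assms(2), of h x] S_add[OF _ assms(2), of h x] by (simp add: add.commute)
    then show "S t ((S h x - x) /\<^sub>R h) = (S h (S t x) - S t x) /\<^sub>R h"
      by (simp add: blinfun.scaleR_right blinfun.diff_right)
  qed
  ultimately have "((\<lambda>h. (S h (S t x) - S t x) /\<^sub>R h) \<longlongrightarrow> S t (G x)) (at_right 0)"
    by (rule Lim_transform_eventually)
  from generator_limitD[OF this] show "S t x \<in> D" "G (S t x) = S t (G x)" .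
qed

lemma orbit_derivative:
  assumes "x \<in> D" "0 \<le> t"
  shows "((\<lambda>s. S s x) has_vector_derivative S t (G x)) (at t within {0..})"
  unfolding has_vector_derivative_slope
proof -
  let ?F = "at t within {0..}"
  have lim: "filterlim (\<lambda>s. \<bar>s - t\<bar>) (at_right 0) ?F"
    unfolding filterlim_at
    by (auto simp: eventually_at_filter intro!: tendsto_eq_intros)
  \<comment> \<open>The terms \<open>min s t\<close> and \<open>\<bar>s - t\<bar>\<close> treat both
    one-sided derivatives at once: the quotient at time zero is transported by the semigroup, and
    joint continuity gives the limit.\<close>
  have "((\<lambda>s. S (min s t) ((S \<bar>s - t\<bar> x - x) /\<^sub>R \<bar>s - t\<bar>)) \<longlongrightarrow> S t (G x)) ?F"
    by (intro tendsto_orbit filterlim_compose[OF generator_limit[OF assms(1)] lim])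
      (use assms in \<open>auto intro!: tendsto_eq_intros simp: eventually_at_filter\<close>)
  moreover have "\<forall>\<^sub>F s in ?F. S (min s t) ((S \<bar>s - t\<bar> x - x) /\<^sub>R \<bar>s - t\<bar>)
      = (S s x - S t x) /\<^sub>R (s - t)"
  proof -
    have "S (min s t) ((S \<bar>s - t\<bar> x - x) /\<^sub>R \<bar>s - t\<bar>) = (S s x - S t x) /\<^sub>R (s - t)"
      if "0 \<le> s" "s \<noteq> t" for s
    proof (cases "s < t")
      case True
      then have "S s (S (t - s) x) = S t x" using S_add[of s "t - s" x] that by simp
      moreover have "inverse (t - s) = - inverse (s - t)"
        by (metis inverse_minus_eq minus_diff_eq)
      ultimately show ?thesis using True
        by (simp add: blinfun.scaleR_right blinfun.diff_right scaleR_diff_right)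
    next
      case False
      then have "S t (S (s - t) x) = S s x" using S_add[of t "s - t" x] assms by simp
      then show ?thesis using False
        by (simp add: blinfun.scaleR_right blinfun.diff_right)
    qed
    then show ?thesis by (auto simp: eventually_at_filter)
  qed
  ultimately show "((\<lambda>s. (S s x - S t x) /\<^sub>R (s - t)) \<longlongrightarrow> S t (G x)) ?F"
    by (rule Lim_transform_eventually)
qed

text \<open>The averages \<open>I h / h\<close> of an orbit tend to \<open>x\<close>. They lie in
  the domain because \<open>S h (I t) - I t\<close> reduces to two short integrals at the ends of
  the interval.\<close>

lemma dense_domain: "closure D = UNIV"
proof -
  have "x \<in> closure D" for x
  proof -
    define I where "I t = integral {0..t} (\<lambda>s. S s x)" for t
    have int: "(\<lambda>s. S s x) integrable_on {a..b}" if "0 \<le> a" for a b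
      by (rule integrable_continuous_real)
        (use that continuous_on_subset[OF continuous_orbit] in auto)
    have I_deriv: "((\<lambda>h. (I (t + h) - I t) /\<^sub>R h) \<longlongrightarrow> S t x) (at_right 0)" if "0 \<le> t" for t
    proof (rule right_difference_quotient)
      have "(I has_vector_derivative S t x) (at t within {0..t + 1})"
        unfolding I_def
        by (rule integral_has_vector_derivative)
          (use that continuous_on_subset[OF continuous_orbit] in auto)
      then show "(I has_vector_derivative S t x) (at t within {t..t + 1})"
        by (rule has_vector_derivative_within_subset) (use that in auto)
    qed simp
    have in_D: "I t \<in> D" if "0 \<le> t" for t
    proof (rule generator_limitD)
      have "((\<lambda>h. (I (t + h) - I t) /\<^sub>R h - (I (0 + h) - I 0) /\<^sub>R h) \<longlongrightarrow> S t x - S 0 x) (at_right 0)"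
        using that by (intro tendsto_diff I_deriv) auto
      moreover have "\<forall>\<^sub>F h in at_right 0. (I (t + h) - I t) /\<^sub>R h - (I (0 + h) - I 0) /\<^sub>R h
          = (S h (I t) - I t) /\<^sub>R h"
      proof -
        have "S h (I t) = I (t + h) - I h" if "0 < h" for h
        proof -
          have "S h (I t) = integral {0..t} (\<lambda>s. S h (S s x))"
            unfolding I_def
            by (rule integral_linear[OF int blinfun.bounded_linear_right, unfolded o_def, symmetric]) simp
          also have "\<dots> = integral {0..t} (\<lambda>s. S (s + h) x)"
            using \<open>0 < h\<close> by (intro integral_cong) (simp add: S_add[symmetric] add.commute)
          also have "\<dots> = integral {h..t + h} (\<lambda>s. S s x)"
            using integral_shift_Icc_real[of 0 t "\<lambda>s. S s x" h] by (simp add: o_def add.commute)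
          also have "\<dots> = I (t + h) - I h"
            using Henstock_Kurzweil_Integration.integral_combine[of 0 h "t + h" "\<lambda>s. S s x"] int[of 0 "t + h"] \<open>0 < h\<close> \<open>0 \<le> t\<close>
            by (simp add: I_def algebra_simps)
          finally show ?thesis .
        qed
        moreover have "I 0 = 0" by (simp add: I_def)
        ultimately show ?thesis
          by (intro eventually_mono[OF eventually_at_right_less[of 0]])
            (simp add: scaleR_diff_right[symmetric])
      qed
      ultimately show "((\<lambda>h. (S h (I t) - I t) /\<^sub>R h) \<longlongrightarrow> S t x - S 0 x) (at_right 0)"
        by (rule Lim_transform_eventually)
    qed
    have scale: "c *\<^sub>R y \<in> D" if "y \<in> D" for c y
    proof (rule generator_limitD)
      have "((\<lambda>h. c *\<^sub>R ((S h y - y) /\<^sub>R h)) \<longlongrightarrow> c *\<^sub>R G y) (at_right 0)"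
        by (rule tendsto_scaleR[OF tendsto_const generator_limit[OF that]])
      then show "((\<lambda>h. (S h (c *\<^sub>R y) - c *\<^sub>R y) /\<^sub>R h) \<longlongrightarrow> c *\<^sub>R G y) (at_right 0)"
        by (simp add: blinfun.scaleR_right scaleR_diff_right mult.commute)
    qed
    have "((\<lambda>h. I h /\<^sub>R h) \<longlongrightarrow> x) (at_right 0)"
      using I_deriv[of 0] by (simp add: I_def)
    moreover have "\<forall>\<^sub>F h in at_right 0. I h /\<^sub>R h \<in> closure D"
      using in_D scale closure_subset[of D]
      by (intro eventually_mono[OF eventually_at_right_less[of 0]]) auto
    ultimately show ?thesis
      by (intro Lim_in_closed_set[of "closure D" _ "at_right 0"]) auto
  qed
  then show ?thesis by auto
qed

end

section \<open>Bounded perturbations\<close>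

context growth_semigroup
begin

text \<open>The mild solution of \<open>u' = G u + f\<close> with \<open>u 0 = 0\<close>.\<close>

definition conv :: "(real \<Rightarrow> 'x) \<Rightarrow> real \<Rightarrow> 'x" where
  "conv f t = integral {0..t} (\<lambda>s. S (t - s) (f s))"

lemma continuous_conv_integrand:
  assumes "continuous_on {0..} f" "0 \<le> a" "b \<le> t"
  shows "continuous_on {a..b} (\<lambda>s. S (t - s) (f s))"
  by (rule continuous_on_orbit)
    (use assms in \<open>auto intro!: continuous_intros intro: continuous_on_subset\<close>)

lemmas integrable_conv_integrand = integrable_continuous_real[OF continuous_conv_integrand]

text \<open>The substitution \<open>s = t * r\<close> fixes the interval of integration, so
  continuity in \<open>t\<close> and the average at \<open>0\<close> follow from continuity of a
  parameter integral.\<close>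

lemma conv_rescale:
  assumes f: "continuous_on {0..} f" and t: "0 < t"
  shows "conv f t = t *\<^sub>R integral {0..1} (\<lambda>r. S (t * (1 - r)) (f (t * r)))"
proof -
  have "((\<lambda>s. S (t - s) (f s)) has_integral conv f t) (cbox 0 t)"
    unfolding conv_def
    using integrable_conv_integrand[OF f order_refl order_refl, of t]
    by (simp add: integrable_integral)
  from has_integral_affinity'[OF this t, of 0]
  have "((\<lambda>r. S (t * (1 - r)) (f (t * r))) has_integral conv f t /\<^sub>R t) {0..1}"
    using t by (simp add: algebra_simps)
  then show ?thesis using t by (simp add: integral_unique)
qed

lemma continuous_conv_average:
  assumes "continuous_on {0..} f"
  shows "continuous_on {0..} (\<lambda>t. integral {0..1} (\<lambda>r. S (t * (1 - r)) (f (t * r))))"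
proof -
  have "continuous_on ({0..} \<times> cbox 0 1) (\<lambda>(t, r). S (t * (1 - r)) (f (t * r)))"
    unfolding split_beta
    by (intro continuous_on_orbit continuous_on_compose2[OF assms] continuous_intros) auto
  from integral_continuous_on_param[OF this] show ?thesis by simp
qed

lemma continuous_conv:
  assumes "continuous_on {0..} f"
  shows "continuous_on {0..} (conv f)"
proof (rule continuous_on_eq)
  show "continuous_on {0..} (\<lambda>t. t *\<^sub>R integral {0..1} (\<lambda>r. S (t * (1 - r)) (f (t * r))))"
    by (intro continuous_intros continuous_conv_average assms)
  show "t *\<^sub>R integral {0..1} (\<lambda>r. S (t * (1 - r)) (f (t * r))) = conv f t" if "t \<in> {0..}" for t
    using that conv_rescale[OF assms, of t] by (cases "t = 0") (auto simp: conv_def)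
qed

lemma conv_average_tendsto:
  assumes f: "continuous_on {0..} f"
  shows "((\<lambda>t. conv f t /\<^sub>R t) \<longlongrightarrow> f 0) (at_right 0)"
proof -
  let ?A = "\<lambda>t. integral {0..1} (\<lambda>r. S (t * (1 - r)) (f (t * r)))"
  have "(?A \<longlongrightarrow> ?A 0) (at 0 within {0..})"
    using continuous_conv_average[OF f] unfolding continuous_on_def by (rule bspec) simp
  then have "(?A \<longlongrightarrow> f 0) (at_right 0)"
    by (rule tendsto_within_subset[where T = "{0<..}", simplified, THEN tendsto_eq_rhs])
      auto
  moreover have "\<forall>\<^sub>F t in at_right 0. ?A t = conv f t /\<^sub>R t"
    by (rule eventually_mono[OF eventually_at_right_less[of 0]]) (simp add: conv_rescale[OF f])
  ultimately show ?thesis by (rule Lim_transform_eventually)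
qed

lemma conv_diff:
  assumes "continuous_on {0..} f" "continuous_on {0..} g"
  shows "conv (\<lambda>s. f s - g s) t = conv f t - conv g t"
  unfolding conv_def blinfun.diff_right
  by (rule integral_diff) (auto intro!: integrable_conv_integrand assms)

lemma conv_add:
  assumes "continuous_on {0..} f" "continuous_on {0..} g"
  shows "conv (\<lambda>s. f s + g s) t = conv f t + conv g t"
  unfolding conv_def blinfun.add_right
  by (rule integral_add) (auto intro!: integrable_conv_integrand assms)

lemma conv_scaleR: "conv (\<lambda>s. c *\<^sub>R f s) t = c *\<^sub>R conv f t"
  unfolding conv_def blinfun.scaleR_right by (rule integral_cmul)

lemma conv_cong: "(\<And>s. 0 \<le> s \<Longrightarrow> f s = g s) \<Longrightarrow> conv f t = conv g t"
  unfolding conv_def by (rule integral_cong) auto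

text \<open>The inhomogeneous part can be restarted at time \<open>s\<close>; this is what gives the
  perturbed family its semigroup law.\<close>

lemma conv_time_add:
  assumes f: "continuous_on {0..} f" and "0 \<le> s" "0 \<le> t"
  shows "conv f (s + t) = S t (conv f s) + conv (\<lambda>r. f (s + r)) t"
proof -
  let ?h = "\<lambda>r. S (s + t - r) (f r)"
  have "S t (conv f s) = integral {0..s} (\<lambda>r. S t (S (s - r) (f r)))"
    unfolding conv_def
    by (rule integral_linear[OF integrable_conv_integrand blinfun.bounded_linear_right,
          unfolded o_def, symmetric]) (use f in auto)
  also have "\<dots> = integral {0..s} ?h"
  proof (rule integral_cong)
    show "S t (S (s - r) (f r)) = ?h r" if "r \<in> {0..s}" for r
      using S_add[OF \<open>0 \<le> t\<close>, of "s - r" "f r"] that by (simp add: add_diff_eq add.commute)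
  qed
  finally have 1: "S t (conv f s) = integral {0..s} ?h" .
  have "conv (\<lambda>r. f (s + r)) t = integral {0..t} (?h \<circ> (+) s)"
    unfolding conv_def by (intro integral_cong) (simp add: algebra_simps)
  also have "\<dots> = integral {s..s + t} ?h"
    by (simp add: integral_shift_Icc_real add.commute)
  finally have 2: "conv (\<lambda>r. f (s + r)) t = integral {s..s + t} ?h" .
  have "integral {0..s} ?h + integral {s..s + t} ?h = integral {0..s + t} ?h"
    using assms by (intro Henstock_Kurzweil_Integration.integral_combine integrable_conv_integrand) auto
  then show ?thesis unfolding 1 2 by (simp add: conv_def)
qed

lemma norm_conv_le:
  assumes f: "continuous_on {0..} f" and g: "g integrable_on {0..t}"
    and le: "\<And>s. 0 \<le> s \<Longrightarrow> s \<le> t \<Longrightarrow> M * exp (w * (t - s)) * norm (f s) \<le> g s"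
  shows "norm (conv f t) \<le> integral {0..t} g"
  unfolding conv_def
proof (rule integral_norm_bound_integral)
  show "(\<lambda>s. S (t - s) (f s)) integrable_on {0..t}"
    by (rule integrable_conv_integrand[OF f]) auto
  show "norm (S (t - s) (f s)) \<le> g s" if "s \<in> {0..t}" for s
    using growth_apply[of "t - s" "f s"] le[of s] that by force
qed (rule g)

text \<open>The weight \<open>exp (l t)\<close> turns the Volterra operator of the variation of constants formula
  into a contraction with factor one half.\<close>

lemma norm_conv_weighted:
  fixes F :: "'x \<Rightarrow>\<^sub>L 'x"
  assumes f: "continuous_on {0..} f" and "0 \<le> t" "0 \<le> c"
    and le: "\<And>s. 0 \<le> s \<Longrightarrow> norm (f s) \<le> c * exp (l * s)"
    and l: "l = w + 2 * M * norm F + 1"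
  shows "norm (conv (\<lambda>s. F (f s)) t) \<le> c / 2 * exp (l * t)"
proof -
  define \<mu> where "\<mu> = l - w"
  define k where "k = M * norm F * c * exp (w * t)"
  have k: "0 \<le> k" using M_nonneg \<open>0 \<le> c\<close> by (simp add: k_def)
  \<comment> \<open>The choice of \<open>l\<close> gives
    \<open>M * norm F / \<mu> \<le> 1 / 2\<close>, the contraction factor; its \<open>+ 1\<close>
    keeps \<open>\<mu>\<close> positive when \<open>F = 0\<close>.\<close>
  have \<mu>: "2 * M * norm F \<le> \<mu>" "0 < \<mu>" using M_nonneg by (simp_all add: \<mu>_def l add_nonneg_pos)
  have "((\<lambda>s. k * exp (\<mu> * s)) has_integral (k * exp (\<mu> * t) / \<mu> - k * exp (\<mu> * 0) / \<mu>)) {0..t}"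
    using \<mu>(2) \<open>0 \<le> t\<close>
    by (intro fundamental_theorem_of_calculus)
      (auto intro!: derivative_eq_intros simp: has_real_derivative_iff_has_vector_derivative[symmetric])
  then have hi: "(\<lambda>s. k * exp (\<mu> * s)) integrable_on {0..t}"
    "integral {0..t} (\<lambda>s. k * exp (\<mu> * s)) \<le> k * exp (\<mu> * t) / \<mu>"
    using k \<mu>(2) by (auto simp: has_integral_iff)
  have "norm (conv (\<lambda>s. F (f s)) t) \<le> integral {0..t} (\<lambda>s. k * exp (\<mu> * s))"
  proof (rule norm_conv_le[OF _ hi(1)])
    show "continuous_on {0..} (\<lambda>s. F (f s))" by (intro continuous_intros f)
    fix s :: real assume "0 \<le> s" "s \<le> t"
    have "norm (F (f s)) \<le> norm F * (c * exp (l * s))"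
      using norm_blinfun[of F "f s"] le[OF \<open>0 \<le> s\<close>] by (meson mult_left_mono norm_ge_zero order_trans)
    then have "M * exp (w * (t - s)) * norm (F (f s))
        \<le> M * exp (w * (t - s)) * (norm F * (c * exp (l * s)))"
      using M_nonneg by (intro mult_left_mono) simp_all
    also have "\<dots> = M * norm F * c * (exp (w * (t - s)) * exp (l * s))" by simp
    also have "exp (w * (t - s)) * exp (l * s) = exp (w * t) * exp (\<mu> * s)"
      by (simp add: \<mu>_def exp_add[symmetric] algebra_simps)
    finally show "M * exp (w * (t - s)) * norm (F (f s)) \<le> k * exp (\<mu> * s)"
      by (simp add: k_def)
  qed
  also have "\<dots> \<le> k * exp (\<mu> * t) / \<mu>" by (rule hi(2))
  also have "k * exp (\<mu> * t) = (2 * M * norm F) * (c / 2 * exp (l * t))"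
    by (simp add: k_def \<mu>_def exp_add[symmetric] algebra_simps)
  also have "\<dots> / \<mu> \<le> \<mu> * (c / 2 * exp (l * t)) / \<mu>"
    using \<mu> \<open>0 \<le> c\<close> by (intro divide_right_mono mult_right_mono) auto
  finally show ?thesis using \<mu>(2) by simp
qed

text \<open>Each use of the equation halves the bound for the difference of two solutions. The
  constants \<open>a\<close> and \<open>b\<close> may differ, since sums, multiples and time shifts
  of solutions are compared later.\<close>

lemma volterra_unique:
  fixes F :: "'x \<Rightarrow>\<^sub>L 'x"
  assumes u: "continuous_on {0..} u" "\<And>t. 0 \<le> t \<Longrightarrow> norm (u t) \<le> a * exp (l * t)"
      "\<And>t. 0 \<le> t \<Longrightarrow> u t = S t x + conv (\<lambda>s. F (u s)) t"
    and v: "continuous_on {0..} v" "\<And>t. 0 \<le> t \<Longrightarrow> norm (v t) \<le> b * exp (l * t)"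
      "\<And>t. 0 \<le> t \<Longrightarrow> v t = S t x + conv (\<lambda>s. F (v s)) t"
    and l: "l = w + 2 * M * norm F + 1" and "0 \<le> t"
  shows "u t = v t"
proof -
  define d where "d s = u s - v s" for s
  have d: "continuous_on {0..} d" unfolding d_def by (intro continuous_intros u v)
  have eq: "d s = conv (\<lambda>s. F (d s)) s" if "0 \<le> s" for s
  proof -
    have "d s = (S s x + conv (\<lambda>s. F (u s)) s) - (S s x + conv (\<lambda>s. F (v s)) s)"
      by (simp only: d_def u(3)[OF that, symmetric] v(3)[OF that, symmetric])
    also have "\<dots> = conv (\<lambda>s. F (u s) - F (v s)) s"
      by (subst conv_diff) (auto intro!: continuous_intros u(1) v(1))
    finally show ?thesis by (simp add: d_def blinfun.diff_right)
  qed
  have ab: "0 \<le> a + b"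
    using order_trans[OF norm_ge_zero u(2), of 0] order_trans[OF norm_ge_zero v(2), of 0] by simp
  have bound: "norm (d s) \<le> (a + b) / 2 ^ n * exp (l * s)" if "0 \<le> s" for n s
    using that
  proof (induction n arbitrary: s)
    case 0
    then show ?case
      using norm_triangle_ineq4[of "u s" "v s"] u(2)[of s] v(2)[of s]
      by (simp add: d_def algebra_simps)
  next
    case (Suc n)
    have "norm (conv (\<lambda>s. F (d s)) s) \<le> (a + b) / 2 ^ n / 2 * exp (l * s)"
      by (rule norm_conv_weighted[OF d Suc.prems _ Suc.IH l]) (use ab in auto)
    then show ?case using eq[OF Suc.prems] by (simp add: mult.commute)
  qed
  have "(\<lambda>n. (a + b) * exp (l * t) * (1 / 2) ^ n) \<longlonglongrightarrow> (a + b) * exp (l * t) * 0"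
    by (rule tendsto_mult[OF tendsto_const LIMSEQ_power_zero]) simp
  then have "(\<lambda>n. (a + b) / 2 ^ n * exp (l * t)) \<longlonglongrightarrow> 0"
    by (simp add: power_divide)
  then have "norm (d t) \<le> 0"
    by (rule LIMSEQ_le_const) (use bound[OF \<open>0 \<le> t\<close>] in auto)
  then show ?thesis by (simp add: d_def)
qed

text \<open>A contraction on bounded continuous functions once the weight \<open>exp (l * t)\<close>
  is removed. The factor \<open>2\<close> in the bound comes from
  \<open>norm v \<le> M * norm x + norm v / 2\<close>.\<close>

lemma volterra_exists:
  fixes F :: "'x \<Rightarrow>\<^sub>L 'x"
  assumes l: "l = w + 2 * M * norm F + 1"
  shows "\<exists>u. continuous_on {0..} u \<and> (\<forall>t\<ge>0. norm (u t) \<le> 2 * M * norm x * exp (l * t)) \<and>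
    (\<forall>t\<ge>0. u t = S t x + conv (\<lambda>s. F (u s)) t)"
proof -
  define \<Psi> where "\<Psi> v t = exp (- l * t) *\<^sub>R (S t x + conv (\<lambda>s. F (exp (l * s) *\<^sub>R v s)) t)"
    for v :: "real \<Rightarrow> 'x" and t
  have wl: "w \<le> l" using M_nonneg by (simp add: l)
  have cont: "continuous_on {0..} (\<Psi> v)" if "continuous_on {0..} v" for v
    unfolding \<Psi>_def by (intro continuous_intros continuous_orbit continuous_conv that)
  have conv_le: "exp (- l * t) * norm (conv (\<lambda>s. F (exp (l * s) *\<^sub>R v s)) t) \<le> c / 2"
    if "continuous_on {0..} v" "\<And>s. norm (v s) \<le> c" "0 \<le> t" for v c t
  proof -
    have "0 \<le> c" using order_trans[OF norm_ge_zero that(2)] by simp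
    have "norm (conv (\<lambda>s. F (exp (l * s) *\<^sub>R v s)) t) \<le> c / 2 * exp (l * t)"
      by (rule norm_conv_weighted[OF _ \<open>0 \<le> t\<close> \<open>0 \<le> c\<close> _ l])
        (use that in \<open>auto intro!: continuous_intros simp: mult.commute\<close>)
    then have "exp (- l * t) * norm (conv (\<lambda>s. F (exp (l * s) *\<^sub>R v s)) t)
        \<le> exp (- l * t) * (c / 2 * exp (l * t))"
      by (intro mult_left_mono) simp_all
    also have "\<dots> = c / 2" by (simp add: exp_minus)
    finally show ?thesis .
  qed
  have \<Psi>_le: "norm (\<Psi> v t) \<le> M * norm x + c / 2"
    if "continuous_on {0..} v" "\<And>s. norm (v s) \<le> c" "0 \<le> t" for v c t
  proof -
    have "exp (- l * t) * norm (S t x) \<le> exp (- l * t) * (M * exp (w * t) * norm x)"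
      by (intro mult_left_mono growth_apply \<open>0 \<le> t\<close>) simp
    also have "\<dots> = M * norm x * exp ((w - l) * t)"
      by (simp add: exp_add[symmetric] algebra_simps exp_diff exp_minus field_simps)
    also have "\<dots> \<le> M * norm x * 1"
      using wl \<open>0 \<le> t\<close> M_nonneg by (intro mult_left_mono) (auto simp: mult_nonpos_nonneg)
    finally have "exp (- l * t) * norm (S t x) \<le> M * norm x" by simp
    moreover have "norm (\<Psi> v t) \<le> exp (- l * t) * (norm (S t x) + norm (conv (\<lambda>s. F (exp (l * s) *\<^sub>R v s)) t))"
      unfolding \<Psi>_def by (simp add: norm_triangle_ineq)
    ultimately show ?thesis using conv_le[OF that] by (simp add: algebra_simps)
  qed
  \<comment> \<open>Bounded continuous functions live on the whole line here; \<open>max 0 t\<close>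
    extends by the value at time zero.\<close>
  define \<Phi> where "\<Phi> v = Bcontfun (\<lambda>t. \<Psi> (apply_bcontfun v) (max 0 t))" for v :: "real \<Rightarrow>\<^sub>C 'x"
  have norm_v: "norm (apply_bcontfun v s) \<le> norm v" for v :: "real \<Rightarrow>\<^sub>C 'x" and s
    by (rule norm_bounded)
  have \<Phi>: "apply_bcontfun (\<Phi> v) t = \<Psi> (apply_bcontfun v) (max 0 t)" for v t
  proof -
    have "(\<lambda>t. \<Psi> (apply_bcontfun v) (max 0 t)) \<in> bcontfun"
      by (rule bcontfun_normI[where b = "M * norm x + norm v / 2"])
        (auto intro!: continuous_on_compose2[OF cont] continuous_intros \<Psi>_le norm_v)
    then show ?thesis by (simp add: \<Phi>_def Bcontfun_inverse)
  qed
  have "dist (\<Phi> v) (\<Phi> v') \<le> 1 / 2 * dist v v'" for v v'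
    unfolding dist_norm
  proof (rule norm_bound)
    fix t :: real
    have c: "continuous_on {0..} (\<lambda>s. F (exp (l * s) *\<^sub>R apply_bcontfun v s))" for v
      by (intro continuous_intros) auto
    have "apply_bcontfun (\<Phi> v - \<Phi> v') t = exp (- l * max 0 t) *\<^sub>R
        conv (\<lambda>s. F (exp (l * s) *\<^sub>R apply_bcontfun (v - v') s)) (max 0 t)"
      by (simp add: \<Phi> \<Psi>_def scaleR_diff_right blinfun.diff_right conv_diff[OF c c]
          scaleR_add_right)
    then show "norm (apply_bcontfun (\<Phi> v - \<Phi> v') t) \<le> 1 / 2 * norm (v - v')"
      using conv_le[of "apply_bcontfun (v - v')" "norm (v - v')" "max 0 t"]
      by (simp add: norm_bounded del: minus_bcontfun.rep_eq)
  qed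
  then obtain v where v: "\<Phi> v = v"
    using banach_fix_type[of "1 / 2" \<Phi>] by auto
  have norm_le: "norm v \<le> 2 * M * norm x"
  proof -
    have "norm (\<Phi> v) \<le> M * norm x + norm v / 2"
      by (rule norm_bound) (auto simp: \<Phi> intro!: \<Psi>_le norm_v)
    then show ?thesis by (simp add: v)
  qed
  define u where "u t = exp (l * t) *\<^sub>R apply_bcontfun v t" for t
  show ?thesis
  proof (intro exI conjI allI impI)
    show "continuous_on {0..} u" unfolding u_def by (intro continuous_intros) auto
    fix t :: real assume "0 \<le> t"
    have "norm (u t) = exp (l * t) * norm (apply_bcontfun v t)" by (simp add: u_def)
    also have "\<dots> \<le> exp (l * t) * (2 * M * norm x)"
      using order_trans[OF norm_v norm_le] by (intro mult_left_mono) auto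
    finally show "norm (u t) \<le> 2 * M * norm x * exp (l * t)" by (simp add: mult.commute)
    have "apply_bcontfun v t = \<Psi> (apply_bcontfun v) t" using \<Phi>[of v t] \<open>0 \<le> t\<close> by (simp add: v)
    then have "u t = exp (l * t) *\<^sub>R \<Psi> (apply_bcontfun v) t" by (simp add: u_def)
    also have "\<dots> = S t x + conv (\<lambda>s. F (u s)) t"
      by (simp add: \<Psi>_def u_def exp_minus)
    finally show "u t = S t x + conv (\<lambda>s. F (u s)) t" .
  qed
qed

text \<open>Linearity and the semigroup law follow from uniqueness for the Volterra equation. The
  average of the convolution at zero tends to \<open>F x\<close>, so the difference quotients of
  \<open>T\<close> and \<open>S\<close> converge for the same vectors and the domain is unchanged.
  The Duhamel formula is kept for the later L2 estimate.\<close>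

theorem bounded_perturbation:
  fixes F :: "'x \<Rightarrow>\<^sub>L 'x"
  shows "\<exists>T l. growth_semigroup T D (\<lambda>x. G x + F x) (2 * M) l \<and>
    (\<forall>t\<ge>0. \<forall>x. T t x = S t x + conv (\<lambda>s. F (T s x)) t)"
proof -
  define l where l: "l = w + 2 * M * norm F + 1"
  obtain u where cont: "\<And>x. continuous_on {0..} (u x)"
    and bound: "\<And>x t. 0 \<le> t \<Longrightarrow> norm (u x t) \<le> 2 * M * norm x * exp (l * t)"
    and eq: "\<And>x t. 0 \<le> t \<Longrightarrow> u x t = S t x + conv (\<lambda>s. F (u x s)) t"
    using volterra_exists[OF l] by metis
  have contF: "continuous_on {0..} (\<lambda>s. F (u x s))" for x by (intro continuous_intros cont)
  have lin: "bounded_linear (\<lambda>x. u x t)" if t: "0 \<le> t" for t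
  proof (rule bounded_linear_intro)
    fix x y
    show "u (x + y) t = u x t + u y t"
    proof (rule volterra_unique[OF cont bound eq _ _ _ l t])
      show "norm (u x s + u y s) \<le> (2 * M * norm x + 2 * M * norm y) * exp (l * s)" if "0 \<le> s" for s
        using norm_triangle_ineq[of "u x s" "u y s"] bound[OF that, of x] bound[OF that, of y]
        by (simp add: algebra_simps)
      show "u x s + u y s = S s (x + y) + conv (\<lambda>s. F (u x s + u y s)) s" if "0 \<le> s" for s
        using eq[OF that, of x] eq[OF that, of y]
        by (simp add: blinfun.add_right conv_add[OF contF contF])
    qed (auto intro!: continuous_intros cont)
  next
    fix r x
    show "u (r *\<^sub>R x) t = r *\<^sub>R u x t"
    proof (rule volterra_unique[OF cont bound eq _ _ _ l t])
      show "norm (r *\<^sub>R u x s) \<le> (\<bar>r\<bar> * (2 * M * norm x)) * exp (l * s)" if "0 \<le> s" for s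
        using mult_left_mono[OF bound[OF that, of x], of "\<bar>r\<bar>"] by (simp add: mult.assoc)
      show "r *\<^sub>R u x s = S s (r *\<^sub>R x) + conv (\<lambda>s. F (r *\<^sub>R u x s)) s" if "0 \<le> s" for s
        by (subst eq[OF that]) (simp add: blinfun.scaleR_right conv_scaleR scaleR_add_right)
    qed (auto intro!: continuous_intros cont)
  next
    show "norm (u x t) \<le> norm x * (2 * M * exp (l * t))" for x
      using bound[OF t, of x] by (simp add: ac_simps)
  qed
  define T where "T t = Blinfun (\<lambda>x. u x t)" for t
  have T: "T t x = u x t" if "0 \<le> t" for t x
    unfolding T_def by (simp add: bounded_linear_Blinfun_apply[OF lin[OF that]])
  have duhamel: "T t x = S t x + conv (\<lambda>s. F (T s x)) t" if "0 \<le> t" for t x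
  proof -
    have "conv (\<lambda>s. F (T s x)) t = conv (\<lambda>s. F (u x s)) t"
      by (rule conv_cong) (simp add: T)
    then show ?thesis using eq[OF that, of x] by (simp add: T[OF that])
  qed
  have T0: "T 0 x = x" for x using duhamel[of 0 x] by (simp add: conv_def)
  have contFT: "continuous_on {0..} (\<lambda>s. F (T s x))" for x
    by (rule continuous_on_eq[OF contF]) (simp add: T)
  have T_add: "T (s + t) x = T s (T t x)" if "0 \<le> s" "0 \<le> t" for s t x
  proof -
    \<comment> \<open>Both sides solve, in the variable \<open>s\<close>, the Volterra equation with
      initial value \<open>u x t\<close>.\<close>
    have "u x (t + s) = u (u x t) s"
    proof (rule volterra_unique[OF _ _ _ cont bound eq l \<open>0 \<le> s\<close>])
      show "continuous_on {0..} (\<lambda>s. u x (t + s))"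
        by (intro continuous_on_compose2[OF cont] continuous_intros) (use that in auto)
      show "norm (u x (t + s)) \<le> (2 * M * norm x * exp (l * t)) * exp (l * s)" if "0 \<le> s" for s
        using bound[of "t + s" x] that \<open>0 \<le> t\<close> by (simp add: exp_add[symmetric] algebra_simps)
      show "u x (t + s) = S s (u x t) + conv (\<lambda>s. F (u x (t + s))) s" if "0 \<le> s" for s
        using eq[of "t + s" x] conv_time_add[OF contF \<open>0 \<le> t\<close> that, of x]
          eq[OF \<open>0 \<le> t\<close>, of x] S_add[OF that \<open>0 \<le> t\<close>, of x] that \<open>0 \<le> t\<close>
        by (simp add: blinfun.add_right add.commute)
    qed
    then show ?thesis using that by (simp add: T add.commute)
  qed
  have quot: "((\<lambda>h. conv (\<lambda>s. F (T s x)) h /\<^sub>R h) \<longlongrightarrow> F x) (at_right 0)" for x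
    using conv_average_tendsto[OF contFT, of x] by (simp add: T0)
  have split: "\<forall>\<^sub>F h in at_right 0. (S h x - x) /\<^sub>R h + conv (\<lambda>s. F (T s x)) h /\<^sub>R h = (T h x - x) /\<^sub>R h"
    for x
  proof (rule eventually_mono[OF eventually_at_right_less[of 0]])
    fix h :: real assume "0 < h"
    then have "T h x - x = (S h x - x) + conv (\<lambda>s. F (T s x)) h" using duhamel[of h x] by simp
    then show "(S h x - x) /\<^sub>R h + conv (\<lambda>s. F (T s x)) h /\<^sub>R h = (T h x - x) /\<^sub>R h"
      by (simp only: scaleR_add_right)
  qed
  have gen_to: "((\<lambda>h. (T h x - x) /\<^sub>R h) \<longlongrightarrow> G x + F x) (at_right 0)" if "x \<in> D" for x
    by (rule Lim_transform_eventually[OF tendsto_add[OF generator_limit[OF that] quot] split])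
  have gen_from: "x \<in> D" if "((\<lambda>h. (T h x - x) /\<^sub>R h) \<longlongrightarrow> y) (at_right 0)" for x y
  proof (rule generator_limitD)
    show "((\<lambda>h. (S h x - x) /\<^sub>R h) \<longlongrightarrow> y - F x) (at_right 0)"
    proof (rule Lim_transform_eventually[OF tendsto_diff[OF that quot]])
      show "\<forall>\<^sub>F h in at_right 0. (T h x - x) /\<^sub>R h - conv (\<lambda>s. F (T s x)) h /\<^sub>R h = (S h x - x) /\<^sub>R h"
        using split[of x] by eventually_elim (metis add_diff_cancel_right')
    qed
  qed
  have "growth_semigroup T D (\<lambda>x. G x + F x) (2 * M) l"
  proof
    show "C0_semigroup T"
      unfolding C0_semigroup_def
    proof (intro conjI allI impI)
      show "T 0 = id_blinfun" by (rule blinfun_eqI) (simp add: T0)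
      show "T (s + t) = T s o\<^sub>L T t" if "0 \<le> s" "0 \<le> t" for s t
        by (rule blinfun_eqI) (simp add: T_add that)
      fix x
      have "(u x \<longlongrightarrow> u x 0) (at 0 within {0..})" using cont[of x] by (simp add: continuous_on_def)
      then have "(u x \<longlongrightarrow> u x 0) (at_right 0)"
        by (rule tendsto_within_subset) auto
      then have "(u x \<longlongrightarrow> x) (at_right 0)" using T0[of x] T[of 0 x] by simp
      then show "((\<lambda>t. T t x) \<longlongrightarrow> x) (at_right 0)"
        by (rule Lim_transform_eventually)
          (rule eventually_mono[OF eventually_at_right_less[of 0]], simp add: T)
    qed
    show "is_generator T D (\<lambda>x. G x + F x)"
      unfolding is_generator_def using gen_to gen_from by blast
    show "norm (T t) \<le> 2 * M * exp (l * t)" if "0 \<le> t" for t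
      by (rule norm_blinfun_bound) (use M_nonneg bound[OF that] that in \<open>auto simp: T ac_simps\<close>)
  qed
  with duhamel show ?thesis by blast
qed

end

section \<open>Lyapunov equations and exponential stability\<close>

lemma blinfun_of_bounded_bilinear:
  assumes "bounded_bilinear f"
  shows "\<exists>P. \<forall>x y. blinfun_apply (blinfun_apply P x) y = f x y"
proof -
  interpret f: bounded_bilinear f by fact
  have "Blinfun f.prod_right x y = f x y" for x y
    by (simp add: bounded_linear_Blinfun_apply f.bounded_linear_prod_right)
  then show ?thesis by blast
qed

lemma norm_blinfun_le_dense:
  assumes "closure D = UNIV" "0 \<le> k" "\<And>x. x \<in> D \<Longrightarrow> norm (blinfun_apply F x) \<le> k * norm x"
  shows "norm F \<le> k"
proof (rule norm_blinfun_bound[OF \<open>0 \<le> k\<close>])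
  fix x
  have "norm (F x) - k * norm x \<le> 0"
    by (rule continuous_le_on_closure[where S = D])
      (use assms in \<open>auto intro!: continuous_intros simp: assms(3)\<close>)
  then show "norm (F x) \<le> k * norm x" by simp
qed

lemma integral_exp_le:
  fixes a t :: real
  assumes "a < 0" "0 \<le> t"
  shows "(\<lambda>s. exp (a * s)) integrable_on {0..t}" "integral {0..t} (\<lambda>s. exp (a * s)) \<le> 1 / - a"
proof -
  have "((\<lambda>s. exp (a * s)) has_integral (exp (a * t) / a - exp (a * 0) / a)) {0..t}"
    using assms
    by (intro fundamental_theorem_of_calculus)
      (auto intro!: derivative_eq_intros simp: has_real_derivative_iff_has_vector_derivative[symmetric])
  then show "(\<lambda>s. exp (a * s)) integrable_on {0..t}" "integral {0..t} (\<lambda>s. exp (a * s)) \<le> 1 / - a"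
    using assms by (auto simp: has_integral_iff divide_nonneg_neg)
qed

text \<open>Young's inequality \<open>L\<^sup>1 * L\<^sup>2 \<subseteq> L\<^sup>2\<close> for the exponential kernel: the convolution \<open>W\<close> solves
  \<open>W' = w W + g\<close>, so \<open>(W\<^sup>2)' \<le> w W\<^sup>2 - g\<^sup>2 / w\<close>.\<close>

lemma exp_convolution_L2:
  fixes g :: "real \<Rightarrow> real" and w \<tau> :: real
  defines "W \<equiv> \<lambda>t. exp (w * t) * integral {0..t} (\<lambda>s. exp (- w * s) * g s)"
  assumes "w < 0" "0 \<le> \<tau>" and g: "continuous_on {0..} g"
  shows "continuous_on {0..\<tau>} W"
    and "integral {0..\<tau>} (\<lambda>s. (W s)\<^sup>2) \<le> integral {0..\<tau>} (\<lambda>s. (g s)\<^sup>2) / w\<^sup>2"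
proof -
  have g': "continuous_on {0..\<tau>} g" by (rule continuous_on_subset[OF g]) auto
  have W': "(W has_real_derivative w * W t + g t) (at t within {0..\<tau>})" if "t \<in> {0..\<tau>}" for t
  proof -
    have E': "((\<lambda>t. exp (w * t)) has_real_derivative w * exp (w * t)) (at t within {0..\<tau>})"
      by (auto intro!: derivative_eq_intros)
    have I': "((\<lambda>t. integral {0..t} (\<lambda>s. exp (- w * s) * g s)) has_real_derivative exp (- w * t) * g t)
        (at t within {0..\<tau>})"
      by (rule integral_has_real_derivative) (use that g' in \<open>auto intro!: continuous_intros\<close>)
    show ?thesis
      unfolding W_def
      by (rule DERIV_cong[OF DERIV_mult[OF E' I']]) (simp add: exp_minus)
  qed
  show W: "continuous_on {0..\<tau>} W"
    by (rule DERIV_continuous_on[OF W'])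
  \<comment> \<open>The mixed term is split so that half of the damping \<open>2 * w\<close>
    survives.\<close>
  have amgm: "2 * W t * (w * W t + g t) \<le> w * (W t)\<^sup>2 + (g t)\<^sup>2 / - w" for t
  proof -
    have "0 \<le> (w * W t + g t)\<^sup>2 / - w" by (rule divide_nonneg_pos) (use \<open>w < 0\<close> in auto)
    also have "\<dots> = - w * (W t)\<^sup>2 - 2 * W t * g t + (g t)\<^sup>2 / - w"
      using \<open>w < 0\<close> by (simp add: power2_eq_square field_simps)
    finally show ?thesis by (simp add: power2_eq_square algebra_simps)
  qed
  have int: "(\<lambda>s. (W s)\<^sup>2) integrable_on {0..\<tau>}" "(\<lambda>s. (g s)\<^sup>2) integrable_on {0..\<tau>}"
    by (auto intro!: integrable_continuous_real continuous_intros W g')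
  have "((\<lambda>s. (W s)\<^sup>2) has_real_derivative 2 * W t * (w * W t + g t)) (at t within {0..\<tau>})"
    if "t \<in> {0..\<tau>}" for t
    by (rule derivative_eq_intros W'[OF that] refl)+ simp
  then have "((\<lambda>s. 2 * W s * (w * W s + g s)) has_integral (W \<tau>)\<^sup>2 - (W 0)\<^sup>2) {0..\<tau>}"
    by (intro fundamental_theorem_of_calculus \<open>0 \<le> \<tau>\<close>)
      (simp add: has_real_derivative_iff_has_vector_derivative)
  moreover have "((\<lambda>s. w * (W s)\<^sup>2 + (g s)\<^sup>2 / - w) has_integral
      w * integral {0..\<tau>} (\<lambda>s. (W s)\<^sup>2) + integral {0..\<tau>} (\<lambda>s. (g s)\<^sup>2) / - w) {0..\<tau>}"
    by (intro has_integral_add has_integral_mult_right has_integral_divide integrable_integral int)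
  ultimately have "(W \<tau>)\<^sup>2 - (W 0)\<^sup>2
      \<le> w * integral {0..\<tau>} (\<lambda>s. (W s)\<^sup>2) + integral {0..\<tau>} (\<lambda>s. (g s)\<^sup>2) / - w"
    by (rule has_integral_le) (rule amgm)
  moreover have "W 0 = 0" by (simp add: W_def)
  ultimately have "0 \<le> w * integral {0..\<tau>} (\<lambda>s. (W s)\<^sup>2) + integral {0..\<tau>} (\<lambda>s. (g s)\<^sup>2) / - w"
    by (smt (verit) power_zero_numeral zero_le_power2)
  then have "w\<^sup>2 * integral {0..\<tau>} (\<lambda>s. (W s)\<^sup>2) \<le> integral {0..\<tau>} (\<lambda>s. (g s)\<^sup>2)"
    using \<open>w < 0\<close> by (simp add: power2_eq_square field_simps)
  then show "integral {0..\<tau>} (\<lambda>s. (W s)\<^sup>2) \<le> integral {0..\<tau>} (\<lambda>s. (g s)\<^sup>2) / w\<^sup>2"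
    using \<open>w < 0\<close> by (simp add: pos_le_divide_eq mult.commute)
qed

section \<open>Energy estimates, Lyapunov equations and Datko's theorem\<close>

context growth_semigroup
begin

lemma continuous_orbit_Icc: "0 \<le> a \<Longrightarrow> continuous_on {a..b} (\<lambda>s. S s x)"
  by (rule continuous_on_subset[OF continuous_orbit]) auto

lemma form_derivative:
  fixes q :: "'x \<Rightarrow>\<^sub>L 'x \<Rightarrow>\<^sub>L real"
  assumes "x \<in> D" "y \<in> D" "0 \<le> s"
  shows "((\<lambda>s. q (S s x) (S s y)) has_vector_derivative
    q (S s x) (S s (G y)) + q (S s (G x)) (S s y)) (at s within {0..})"
proof -
  have "((\<lambda>s. q (S s x)) has_vector_derivative q (S s (G x))) (at s within {0..})"
    by (rule bounded_linear.has_vector_derivative[OF blinfun.bounded_linear_right])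
      (rule orbit_derivative[OF assms(1,3)])
  from bounded_bilinear.has_vector_derivative[OF bounded_bilinear_blinfun_apply this
      orbit_derivative[OF assms(2,3)]]
  show ?thesis .
qed

lemma form_orbit_integral:
  fixes q :: "'x \<Rightarrow>\<^sub>L 'x \<Rightarrow>\<^sub>L real"
  assumes "x \<in> D" "y \<in> D" "0 \<le> a" "a \<le> b"
  shows "((\<lambda>s. q (S s x) (S s (G y)) + q (S s (G x)) (S s y)) has_integral
    q (S b x) (S b y) - q (S a x) (S a y)) {a..b}"
  by (rule fundamental_theorem_of_calculus[OF \<open>a \<le> b\<close>])
    (rule has_vector_derivative_within_subset[OF form_derivative[OF assms(1,2)]], use \<open>0 \<le> a\<close> in auto)

lemma energy_inequality:
  fixes P :: "'x \<Rightarrow>\<^sub>L 'x \<Rightarrow>\<^sub>L real"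
  assumes le: "\<And>y. y \<in> D \<Longrightarrow> P y (G y) + P (G y) y \<le> - r y"
    and r: "continuous_on UNIV r" and "x \<in> D" "0 \<le> \<tau>"
  shows "P (S \<tau> x) (S \<tau> x) + integral {0..\<tau>} (\<lambda>s. r (S s x)) \<le> P x x"
proof -
  have "(\<lambda>s. r (S s x)) integrable_on {0..\<tau>}"
    by (intro integrable_continuous_real continuous_on_compose2[OF r] continuous_orbit_Icc) auto
  then have "((\<lambda>s. - r (S s x)) has_integral - integral {0..\<tau>} (\<lambda>s. r (S s x))) {0..\<tau>}"
    by (intro has_integral_neg integrable_integral)
  with form_orbit_integral[OF \<open>x \<in> D\<close> \<open>x \<in> D\<close> order_refl \<open>0 \<le> \<tau>\<close>]
  have "P (S \<tau> x) (S \<tau> x) - P (S 0 x) (S 0 x) \<le> - integral {0..\<tau>} (\<lambda>s. r (S s x))"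
    by (rule has_integral_le)
      (use le orbit_domain[OF \<open>x \<in> D\<close>] in \<open>fastforce simp: orbit_domain(2)[OF \<open>x \<in> D\<close>, symmetric]\<close>)
  then show ?thesis by simp
qed

lemma orbit_tendsto_0:
  assumes "w < 0"
  shows "(\<lambda>n. S (real n) x) \<longlonglongrightarrow> 0"
proof (rule Lim_null_comparison)
  show "\<forall>\<^sub>F n in sequentially. norm (S (real n) x) \<le> M * norm x * exp w ^ n"
    using growth_apply[of "real _" x] by (simp add: exp_of_nat_mult[symmetric] ac_simps)
  have "(\<lambda>n. M * norm x * exp w ^ n) \<longlonglongrightarrow> M * norm x * 0"
    by (rule tendsto_mult[OF tendsto_const LIMSEQ_power_zero]) (use assms in simp)
  then show "(\<lambda>n. M * norm x * exp w ^ n) \<longlonglongrightarrow> 0" by simp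
qed

lemma form_orbit_tendsto_0:
  fixes q :: "'x \<Rightarrow>\<^sub>L 'x \<Rightarrow>\<^sub>L real"
  assumes "w < 0"
  shows "(\<lambda>n. q (S (real n) x) (S (real n) y)) \<longlonglongrightarrow> 0"
  using blinfun.tendsto[OF blinfun.tendsto[OF tendsto_const orbit_tendsto_0[OF assms]]
      orbit_tendsto_0[OF assms], of q x y] by simp

lemma stable_L2:
  assumes "w < 0" "0 \<le> \<tau>"
  shows "integral {0..\<tau>} (\<lambda>s. (norm (S s x))\<^sup>2) \<le> M\<^sup>2 / (- 2 * w) * (norm x)\<^sup>2"
proof -
  note e = integral_exp_le[of "2 * w" \<tau>]
  have "integral {0..\<tau>} (\<lambda>s. (norm (S s x))\<^sup>2) \<le> integral {0..\<tau>} (\<lambda>s. (M * norm x)\<^sup>2 * exp (2 * w * s))"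
  proof (rule integral_le)
    show "(\<lambda>s. (norm (S s x))\<^sup>2) integrable_on {0..\<tau>}"
      by (intro integrable_continuous_real continuous_intros continuous_orbit_Icc) auto
    show "(\<lambda>s. (M * norm x)\<^sup>2 * exp (2 * w * s)) integrable_on {0..\<tau>}"
      by (intro integrable_on_mult_right e) (use assms in auto)
    fix s assume "s \<in> {0..\<tau>}"
    then have "(norm (S s x))\<^sup>2 \<le> (M * exp (w * s) * norm x)\<^sup>2"
      by (intro power_mono growth_apply) auto
    then show "(norm (S s x))\<^sup>2 \<le> (M * norm x)\<^sup>2 * exp (2 * w * s)"
      by (simp add: power_mult_distrib exp_double[symmetric] ac_simps)
  qed
  also have "\<dots> = (M * norm x)\<^sup>2 * integral {0..\<tau>} (\<lambda>s. exp (2 * w * s))" by simp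
  also have "\<dots> \<le> (M * norm x)\<^sup>2 * (1 / - (2 * w))"
    by (intro mult_left_mono e) (use assms in auto)
  finally show ?thesis by (simp add: power_mult_distrib)
qed

text \<open>Integrate up to time \<open>n\<close> and let \<open>n\<close> grow: the boundary term
  vanishes by stability, \<open>c\<close> controls the integral, and density extends the bound from
  \<open>D\<close>. The constant \<open>c\<close> is separate from \<open>M\<close> and
  \<open>w\<close> so that a bound uniform over many semigroups can be inserted.\<close>

lemma stable_comparison:
  fixes R :: "'x \<Rightarrow>\<^sub>L 'x \<Rightarrow>\<^sub>L real"
  assumes "w < 0" "0 \<le> k"
    and L2: "\<And>x \<tau>. x \<in> D \<Longrightarrow> 0 \<le> \<tau> \<Longrightarrow> integral {0..\<tau>} (\<lambda>s. (norm (S s x))\<^sup>2) \<le> c * (norm x)\<^sup>2"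
    and le: "\<And>y. y \<in> D \<Longrightarrow> R y (G y) + R (G y) y \<le> k * (norm y)\<^sup>2"
  shows "- (k * c) * (norm x)\<^sup>2 \<le> R x x"
proof -
  have on_D: "- (k * c) * (norm x)\<^sup>2 \<le> R x x" if "x \<in> D" for x
  proof -
    have "R (S \<tau> x) (S \<tau> x) - k * c * (norm x)\<^sup>2 \<le> R x x" if "0 \<le> \<tau>" for \<tau>
    proof -
      have "R (S \<tau> x) (S \<tau> x) + integral {0..\<tau>} (\<lambda>s. - k * (norm (S s x))\<^sup>2) \<le> R x x"
        by (rule energy_inequality)
          (use le \<open>x \<in> D\<close> that in \<open>auto intro!: continuous_intros\<close>)
      moreover have "integral {0..\<tau>} (\<lambda>s. - k * (norm (S s x))\<^sup>2)
          = - k * integral {0..\<tau>} (\<lambda>s. (norm (S s x))\<^sup>2)" by simp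
      moreover have "k * integral {0..\<tau>} (\<lambda>s. (norm (S s x))\<^sup>2) \<le> k * (c * (norm x)\<^sup>2)"
        by (intro mult_left_mono L2 \<open>x \<in> D\<close> that \<open>0 \<le> k\<close>)
      ultimately show ?thesis by simp
    qed
    moreover have "(\<lambda>n. R (S (real n) x) (S (real n) x) - k * c * (norm x)\<^sup>2)
        \<longlonglongrightarrow> 0 - k * c * (norm x)\<^sup>2"
      by (intro tendsto_diff form_orbit_tendsto_0 \<open>w < 0\<close> tendsto_const)
    ultimately have "0 - k * c * (norm x)\<^sup>2 \<le> R x x"
      by (intro LIMSEQ_le_const2) auto
    then show ?thesis by simp
  qed
  have "0 \<le> R x x + k * c * (norm x)\<^sup>2"
  proof (rule continuous_ge_on_closure[where S = D])
    show "0 \<le> R x x + k * c * (norm x)\<^sup>2" if "x \<in> D" for x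
      using on_D[OF that] by simp
  qed (auto intro!: continuous_intros simp: dense_domain)
  then show ?thesis by simp
qed

lemma stable_nonneg:
  fixes R :: "'x \<Rightarrow>\<^sub>L 'x \<Rightarrow>\<^sub>L real"
  assumes "w < 0" "\<And>y. y \<in> D \<Longrightarrow> R y (G y) + R (G y) y \<le> 0"
  shows "0 \<le> R x x"
  using stable_comparison[OF assms(1) order_refl stable_L2[OF assms(1)], of R x] assms(2) by simp

text \<open>\<open>P x y\<close> is the integral of \<open>q (S s x) (S s y)\<close> over all
  positive times, written as a series over unit intervals with geometric decay; the equation is then
  a telescoping sum.\<close>

lemma lyapunov_exists:
  fixes q :: "'x \<Rightarrow>\<^sub>L 'x \<Rightarrow>\<^sub>L real"
  assumes "w < 0" and q: "q \<in> Bs_pos"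
  shows "\<exists>P\<in>Bs_pos. \<forall>x\<in>D. \<forall>y\<in>D. P x (G y) + P (G x) y = - q x y"
proof -
  define a where "a k x y = integral {real k..real k + 1} (\<lambda>s. q (S s x) (S s y))" for k x y
  have int: "(\<lambda>s. q (S s x) (S s y)) integrable_on {real k..real k + 1}" for k x y
    by (intro integrable_continuous_real continuous_intros continuous_orbit_Icc) auto
  define \<rho> where "\<rho> = exp (2 * w)"
  have \<rho>: "0 < \<rho>" "\<rho> < 1" using \<open>w < 0\<close> by (auto simp: \<rho>_def)
  have a_le: "norm (a k x y) \<le> norm x * norm y * (norm q * M\<^sup>2) * \<rho> ^ k" for k x y
  proof -
    have "norm (a k x y) \<le> integral {real k..real k + 1}
        (\<lambda>s. norm x * norm y * (norm q * M\<^sup>2) * \<rho> ^ k)"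
      unfolding a_def
    proof (rule integral_norm_bound_integral[OF int])
      fix s assume s: "s \<in> {real k..real k + 1}"
      have b: "norm (S s z) \<le> M * exp (w * k) * norm z" for z
      proof -
        have "norm (S s z) \<le> M * exp (w * s) * norm z" using s by (intro growth_apply) auto
        also have "\<dots> \<le> M * exp (w * k) * norm z"
          using s \<open>w < 0\<close> by (intro mult_right_mono mult_left_mono M_nonneg) auto
        finally show ?thesis .
      qed
      have "norm (q (S s x) (S s y)) \<le> norm q * norm (S s x) * norm (S s y)"
        by (rule order_trans[OF norm_blinfun]) (intro mult_right_mono norm_blinfun norm_ge_zero)
      also have "\<dots> \<le> norm q * (M * exp (w * k) * norm x) * (M * exp (w * k) * norm y)"
        by (intro mult_mono mult_nonneg_nonneg b order_refl) (auto intro: M_nonneg)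
      also have "\<dots> = norm x * norm y * (norm q * M\<^sup>2) * (exp (w * k) * exp (w * k))"
        by (simp add: power2_eq_square)
      also have "exp (w * k) * exp (w * k) = \<rho> ^ k"
        by (simp add: \<rho>_def exp_of_nat_mult[symmetric] exp_add[symmetric] algebra_simps)
      finally show "norm (q (S s x) (S s y)) \<le> norm x * norm y * (norm q * M\<^sup>2) * \<rho> ^ k" .
    qed auto
    then show ?thesis by simp
  qed
  have geo: "summable (\<lambda>k. norm x * norm y * (norm q * M\<^sup>2) * \<rho> ^ k)" for x y
    using \<rho> by (intro summable_mult summable_geometric) auto
  have summ: "summable (\<lambda>k. a k x y)" for x y
    by (rule summable_comparison_test'[OF geo a_le])
  define f where "f x y = (\<Sum>k. a k x y)" for x y
  have "bounded_bilinear f"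
  proof
    show "f (x + x') y = f x y + f x' y" for x x' y
      unfolding f_def suminf_add[OF summ summ]
      by (simp add: a_def blinfun.add_right blinfun.add_left integral_add[OF int int])
    show "f x (y + y') = f x y + f x y'" for x y y'
      unfolding f_def suminf_add[OF summ summ]
      by (simp add: a_def blinfun.add_right integral_add[OF int int])
    show "f (r *\<^sub>R x) y = r *\<^sub>R f x y" for r x y
      unfolding f_def suminf_scaleR_right[OF summ]
      by (simp add: a_def blinfun.scaleR_right blinfun.scaleR_left)
    show "f x (r *\<^sub>R y) = r *\<^sub>R f x y" for r x y
      unfolding f_def suminf_scaleR_right[OF summ]
      by (simp add: a_def blinfun.scaleR_right)
    have "norm (f x y) \<le> norm x * norm y * (norm q * M\<^sup>2 / (1 - \<rho>))" for x y
    proof -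
      have "norm (f x y) \<le> (\<Sum>k. norm x * norm y * (norm q * M\<^sup>2) * \<rho> ^ k)"
        unfolding f_def by (rule norm_suminf_le[OF a_le geo])
      also have "\<dots> = norm x * norm y * (norm q * M\<^sup>2) * (1 / (1 - \<rho>))"
        using \<rho> by (simp add: suminf_mult summable_geometric suminf_geometric)
      finally show ?thesis by simp
    qed
    then show "\<exists>K. \<forall>x y. norm (f x y) \<le> norm x * norm y * K" by blast
  qed
  then obtain P :: "'x \<Rightarrow>\<^sub>L 'x \<Rightarrow>\<^sub>L real" where P: "\<And>x y. P x y = f x y"
    using blinfun_of_bounded_bilinear by blast
  have "P \<in> Bs_pos"
    unfolding Bs_pos_def mem_Collect_eq P f_def
    by (auto simp: a_def Bs_pos_sym[OF q] intro!: suminf_nonneg summ[unfolded a_def]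
        Henstock_Kurzweil_Integration.integral_nonneg int Bs_pos_nonneg[OF q])
  moreover have "P x (G y) + P (G x) y = - q x y" if "x \<in> D" "y \<in> D" for x y
  proof -
    have "a k x (G y) + a k (G x) y
        = q (S (real (Suc k)) x) (S (real (Suc k)) y) - q (S (real k) x) (S (real k) y)" for k
      unfolding a_def integral_add[OF int int, symmetric]
      using form_orbit_integral[OF that, of "real k" "real k + 1" q]
      by (simp add: integral_unique add.commute)
    then have "(\<lambda>k. a k x (G y) + a k (G x) y) sums (0 - q (S (real 0) x) (S (real 0) y))"
      using telescope_sums[OF form_orbit_tendsto_0[OF \<open>w < 0\<close>, of q x y]] by simp
    moreover have "(\<lambda>k. a k x (G y) + a k (G x) y) sums (f x (G y) + f (G x) y)"
      unfolding f_def by (intro sums_add summable_sums summ)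
    ultimately show ?thesis using sums_unique2 P by fastforce
  qed
  ultimately show ?thesis by blast
qed

text \<open>Integrating the semigroup law over a window of length one bounds the semigroup; integrating
  it over \<open>[0, t]\<close> then bounds \<open>t \<parallel>S t x\<parallel>\<^sup>2\<close>, so some \<open>S t0\<close> has norm at most one half.\<close>

lemma datko:
  assumes "0 \<le> c"
    and L2: "\<And>x \<tau>. x \<in> D \<Longrightarrow> 0 \<le> \<tau> \<Longrightarrow> integral {0..\<tau>} (\<lambda>s. (norm (S s x))\<^sup>2) \<le> c * (norm x)\<^sup>2"
  shows "\<exists>M' w'. w' < 0 \<and> growth_semigroup S D G M' w'"
proof -
  define b where "b = M * exp \<bar>w\<bar>"
  have b: "norm (S t x) \<le> b * norm x" if "0 \<le> t" "t \<le> 1" for t x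
    using local_bound[OF that, of x] by (simp add: b_def)
  have b0: "0 \<le> b" using M_nonneg by (simp add: b_def)
  have int: "(\<lambda>s. (norm (S s x))\<^sup>2) integrable_on {u..v}" if "0 \<le> u" for u v x
    by (intro integrable_continuous_real continuous_intros continuous_orbit_Icc that)
  \<comment> \<open>Since \<open>S v\<close> factors through every \<open>S s\<close> with
    \<open>s\<close> in the window, a bound \<open>k\<close> on the propagators turns the L2 bound
    into a pointwise one, improving with the length of the window.\<close>
  have window: "(v - u) * (norm (S v x))\<^sup>2 \<le> k\<^sup>2 * (c * (norm x)\<^sup>2)"
    if "x \<in> D" "0 \<le> u" "u \<le> v" "0 \<le> k" "\<And>s z. u \<le> s \<Longrightarrow> s \<le> v \<Longrightarrow> norm (S (v - s) z) \<le> k * norm z"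
    for u v k x
  proof -
    have "(v - u) * (norm (S v x))\<^sup>2 = integral {u..v} (\<lambda>s. (norm (S v x))\<^sup>2)"
      using that by simp
    also have "\<dots> \<le> integral {u..v} (\<lambda>s. k\<^sup>2 * (norm (S s x))\<^sup>2)"
    proof (rule integral_le)
      fix s assume s: "s \<in> {u..v}"
      have "norm (S v x) \<le> k * norm (S s x)"
        using that(5)[of s "S s x"] s S_add[of "v - s" s x] \<open>0 \<le> u\<close> by simp
      then show "(norm (S v x))\<^sup>2 \<le> k\<^sup>2 * (norm (S s x))\<^sup>2"
        by (metis norm_ge_zero power_mono power_mult_distrib)
    qed (auto intro!: integrable_on_mult_right int \<open>0 \<le> u\<close>)
    also have "\<dots> \<le> integral {0..v} (\<lambda>s. k\<^sup>2 * (norm (S s x))\<^sup>2)"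
      by (rule integral_subset_le) (use that in \<open>auto intro!: integrable_on_mult_right int\<close>)
    also have "\<dots> = k\<^sup>2 * integral {0..v} (\<lambda>s. (norm (S s x))\<^sup>2)" by simp
    also have "\<dots> \<le> k\<^sup>2 * (c * (norm x)\<^sup>2)"
      using that by (intro mult_left_mono L2) auto
    finally show ?thesis .
  qed
  \<comment> \<open>\<open>b\<close> serves the times up to \<open>1\<close>; beyond that the window
    from \<open>t - 1\<close> to \<open>t\<close> gives \<open>b * sqrt c\<close>.\<close>
  define N where "N = b * (1 + sqrt c)"
  have N: "b \<le> N" "0 \<le> N" using b0 \<open>0 \<le> c\<close> by (simp_all add: N_def mult_le_cancel_left1)
  have S_le_N: "norm (S t) \<le> N" if "0 \<le> t" for t
  proof (rule norm_blinfun_le_dense[OF dense_domain N(2)])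
    fix x assume "x \<in> D"
    show "norm (S t x) \<le> N * norm x"
    proof (cases "t \<le> 1")
      case True
      then show ?thesis
        using b[OF that True, of x] N(1) by (meson mult_right_mono norm_ge_zero order_trans)
    next
      case False
      then have "(norm (S t x))\<^sup>2 \<le> b\<^sup>2 * (c * (norm x)\<^sup>2)"
        using window[OF \<open>x \<in> D\<close>, of "t - 1" t b] b0 b by simp
      also have "\<dots> = (b * sqrt c * norm x)\<^sup>2"
        using \<open>0 \<le> c\<close> by (simp add: power_mult_distrib)
      finally have "norm (S t x) \<le> b * sqrt c * norm x"
        by (rule power2_le_imp_le) (use b0 \<open>0 \<le> c\<close> in simp)
      also have "\<dots> \<le> N * norm x"
        using b0 by (intro mult_right_mono) (auto simp: N_def algebra_simps)
      finally show ?thesis .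
    qed
  qed
  \<comment> \<open>Chosen so that \<open>N\<^sup>2 * c / t0 \<le> 1 / 4\<close>, the square of the
    desired bound; the \<open>+ 1\<close> keeps \<open>t0\<close> positive when
    \<open>c = 0\<close>.\<close>
  define t0 where "t0 = 4 * (N\<^sup>2 * c) + 1"
  have t0: "0 < t0" using \<open>0 \<le> c\<close> by (simp add: t0_def add_nonneg_pos)
  have half: "norm (S t0) \<le> 1 / 2"
  proof (rule norm_blinfun_le_dense[OF dense_domain])
    fix x assume "x \<in> D"
    have "(t0 - 0) * (norm (S t0 x))\<^sup>2 \<le> N\<^sup>2 * (c * (norm x)\<^sup>2)"
    proof (rule window[OF \<open>x \<in> D\<close>])
      show "norm (S (t0 - s) z) \<le> N * norm z" if "0 \<le> s" "s \<le> t0" for s z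
        using norm_blinfun[of "S (t0 - s)" z] S_le_N[of "t0 - s"] that
        by (meson diff_ge_0_iff_ge mult_right_mono norm_ge_zero order_trans)
    qed (use N t0 in auto)
    also have "\<dots> \<le> t0 / 4 * (norm x)\<^sup>2"
      by (simp add: t0_def algebra_simps)
    finally have "t0 * (norm (S t0 x))\<^sup>2 \<le> t0 * (1 / 2 * norm x)\<^sup>2"
      by (simp add: power_divide)
    then have "(norm (S t0 x))\<^sup>2 \<le> (1 / 2 * norm x)\<^sup>2"
      using t0 by (simp only: mult_le_cancel_left_pos)
    then show "norm (S t0 x) \<le> 1 / 2 * norm x"
      by (rule power2_le_imp_le) simp
  qed simp
  have pow: "norm (S (real n * t0 + r) x) \<le> (1 / 2) ^ n * (N * norm x)" if "0 \<le> r" for n r x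
  proof (induction n)
    case 0
    then show ?case
      using norm_blinfun[of "S r" x] S_le_N[OF that]
      by simp (meson mult_right_mono norm_ge_zero order_trans)
  next
    case (Suc n)
    have "S (real (Suc n) * t0 + r) x = S t0 (S (real n * t0 + r) x)"
      using S_add[of t0 "real n * t0 + r" x] t0 that by (simp add: algebra_simps)
    then have "norm (S (real (Suc n) * t0 + r) x) \<le> norm (S t0) * norm (S (real n * t0 + r) x)"
      by (simp add: norm_blinfun)
    also have "\<dots> \<le> 1 / 2 * ((1 / 2) ^ n * (N * norm x))"
      by (intro mult_mono half Suc.IH) simp_all
    finally show ?case by simp
  qed
  \<comment> \<open>The rate of halving once per period \<open>t0\<close>; rounding
    \<open>t / t0\<close> down costs the extra factor \<open>2\<close> in the next bound.\<close>
  define w' where "w' = - ln 2 / t0"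
  have "norm (S t) \<le> 2 * N * exp (w' * t)" if "0 \<le> t" for t
  proof (rule norm_blinfun_bound)
    fix x
    define n where "n = nat \<lfloor>t / t0\<rfloor>"
    have n: "real n \<le> t / t0" "t / t0 < real n + 1"
      using that t0 by (auto simp: n_def)
    then have "norm (S (real n * t0 + (t - real n * t0)) x) \<le> (1 / 2) ^ n * (N * norm x)"
      using t0 by (intro pow) (simp add: field_simps)
    moreover have "(1 / 2) ^ n \<le> 2 * exp (w' * t)"
    proof -
      have "(1 / 2 :: real) ^ n = exp (- ln 2 * real n)"
        by (simp add: exp_of_nat2_mult exp_minus inverse_eq_divide power_one_over)
      also have "\<dots> \<le> exp (ln 2 + - ln 2 * (t / t0))"
        using n(2) mult_left_mono[of "t / t0" "real n + 1" "ln 2"] by (simp add: algebra_simps)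
      also have "\<dots> = 2 * exp (w' * t)" by (simp only: exp_add) (simp add: w'_def)
      finally show ?thesis .
    qed
    ultimately show "norm (S t x) \<le> 2 * N * exp (w' * t) * norm x"
      using mult_right_mono[of "(1 / 2) ^ n" "2 * exp (w' * t)" "N * norm x"] N by (simp add: ac_simps)
  qed (use N in simp)
  then have "growth_semigroup S D G (2 * N) w'"
    by unfold_locales (use C0 gen in auto)
  moreover have "w' < 0" using t0 by (simp add: w'_def)
  ultimately show ?thesis by blast
qed

text \<open>\<open>F\<close> is dominated by the dissipation \<open>r\<close>, whose integral along
  an orbit of \<open>T\<close> is at most \<open>P x x\<close>; Duhamel's formula and the
  convolution estimate carry this over to the orbit. The constant involves \<open>M\<close> and
  \<open>w\<close> of the unperturbed semigroup and not \<open>M'\<close> and \<open>w'\<close>, so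
  it is uniform over perturbations.\<close>

lemma perturbed_L2:
  fixes F :: "'x \<Rightarrow>\<^sub>L 'x" and P :: "'x \<Rightarrow>\<^sub>L 'x \<Rightarrow>\<^sub>L real"
  assumes "w < 0"
    and T: "growth_semigroup T D (\<lambda>x. G x + F x) M' w'"
    and duhamel: "\<And>t x. 0 \<le> t \<Longrightarrow> T t x = S t x + conv (\<lambda>s. F (T s x)) t"
    and P: "P \<in> Bs_pos" and r: "continuous_on UNIV r" and "0 \<le> c"
    and F: "\<And>y. (norm (F y))\<^sup>2 \<le> c * r y"
    and le: "\<And>y. y \<in> D \<Longrightarrow> P y (G y + F y) + P (G y + F y) y \<le> - r y"
    and "x \<in> D" "0 \<le> \<tau>"
  shows "integral {0..\<tau>} (\<lambda>s. (norm (T s x))\<^sup>2)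
    \<le> (M\<^sup>2 / - w + 2 * M\<^sup>2 / w\<^sup>2 * c * norm P) * (norm x)\<^sup>2"
proof -
  interpret T: growth_semigroup T D "\<lambda>x. G x + F x" M' w' by fact
  define g where "g s = norm (F (T s x))" for s
  define W where "W t = exp (w * t) * integral {0..t} (\<lambda>s. exp (- w * s) * g s)" for t
  have g: "continuous_on {0..} g"
    unfolding g_def by (intro continuous_intros T.continuous_orbit)
  note W = exp_convolution_L2[OF \<open>w < 0\<close> \<open>0 \<le> \<tau>\<close> g, folded W_def]
  have "integral {0..\<tau>} (\<lambda>s. (g s)\<^sup>2) \<le> integral {0..\<tau>} (\<lambda>s. c * r (T s x))"
    by (intro integral_le integrable_continuous_real continuous_intros
        continuous_on_compose2[OF r] T.continuous_orbit_Icc continuous_on_subset[OF g])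
      (auto simp: g_def F)
  also have "\<dots> = c * integral {0..\<tau>} (\<lambda>s. r (T s x))" by simp
  also have "\<dots> \<le> c * (norm P * (norm x)\<^sup>2)"
  proof (rule mult_left_mono[OF _ \<open>0 \<le> c\<close>])
    have "P (T \<tau> x) (T \<tau> x) + integral {0..\<tau>} (\<lambda>s. r (T s x)) \<le> P x x"
      by (rule T.energy_inequality[OF le r \<open>x \<in> D\<close> \<open>0 \<le> \<tau>\<close>])
    then show "integral {0..\<tau>} (\<lambda>s. r (T s x)) \<le> norm P * (norm x)\<^sup>2"
      using Bs_pos_nonneg[OF P, of "T \<tau> x"] form_le[of P x] by linarith
  qed
  finally have g_le: "integral {0..\<tau>} (\<lambda>s. (g s)\<^sup>2) \<le> c * norm P * (norm x)\<^sup>2" by simp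
  have W_le: "integral {0..\<tau>} (\<lambda>s. (W s)\<^sup>2) \<le> c * norm P * (norm x)\<^sup>2 / w\<^sup>2"
    by (rule order_trans[OF W(2) divide_right_mono[OF g_le]]) simp
  have pointwise: "(norm (T t x))\<^sup>2 \<le> 2 * (M\<^sup>2 * (norm x)\<^sup>2) * exp (2 * w * t) + 2 * M\<^sup>2 * (W t)\<^sup>2"
    if "t \<in> {0..\<tau>}" for t
  proof -
    have "norm (conv (\<lambda>s. F (T s x)) t) \<le> integral {0..t} (\<lambda>s. M * exp (w * t) * (exp (- w * s) * g s))"
    proof (rule norm_conv_le)
      show "continuous_on {0..} (\<lambda>s. F (T s x))" by (intro continuous_intros T.continuous_orbit)
      show "(\<lambda>s. M * exp (w * t) * (exp (- w * s) * g s)) integrable_on {0..t}"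
        by (intro integrable_continuous_real continuous_intros continuous_on_subset[OF g]) auto
      show "M * exp (w * (t - s)) * norm (F (T s x)) \<le> M * exp (w * t) * (exp (- w * s) * g s)" for s
        by (simp add: g_def exp_diff exp_minus algebra_simps field_simps)
    qed
    then have "norm (conv (\<lambda>s. F (T s x)) t) \<le> M * W t" by (simp add: W_def mult.assoc)
    moreover have "norm (S t x) \<le> M * exp (w * t) * norm x" using that by (intro growth_apply) auto
    ultimately have "norm (T t x) \<le> M * exp (w * t) * norm x + M * W t"
      using duhamel[of t x] that norm_triangle_ineq[of "S t x" "conv (\<lambda>s. F (T s x)) t"] by simp
    then have "(norm (T t x))\<^sup>2 \<le> (M * exp (w * t) * norm x + M * W t)\<^sup>2"
      by (rule power_mono) simp
    also have "\<dots> \<le> 2 * (M * exp (w * t) * norm x)\<^sup>2 + 2 * (M * W t)\<^sup>2"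
      using sum_squares_bound[of "M * exp (w * t) * norm x" "M * W t"]
      by (simp add: power2_sum)
    finally show ?thesis
      by (simp add: power_mult_distrib exp_double[symmetric] ac_simps)
  qed
  note e = integral_exp_le[of "2 * w" \<tau>]
  have "integral {0..\<tau>} (\<lambda>s. (norm (T s x))\<^sup>2)
      \<le> integral {0..\<tau>} (\<lambda>s. 2 * (M\<^sup>2 * (norm x)\<^sup>2) * exp (2 * w * s) + 2 * M\<^sup>2 * (W s)\<^sup>2)"
    by (intro integral_le pointwise integrable_continuous_real continuous_intros
        T.continuous_orbit_Icc W(1)) auto
  also have "\<dots> = 2 * (M\<^sup>2 * (norm x)\<^sup>2) * integral {0..\<tau>} (\<lambda>s. exp (2 * w * s))
      + 2 * M\<^sup>2 * integral {0..\<tau>} (\<lambda>s. (W s)\<^sup>2)"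
    by (subst integral_add)
      (auto intro!: integrable_continuous_real continuous_intros W(1))
  also have "\<dots> \<le> 2 * (M\<^sup>2 * (norm x)\<^sup>2) * (1 / - (2 * w))
      + 2 * M\<^sup>2 * (c * norm P * (norm x)\<^sup>2 / w\<^sup>2)"
    by (intro add_mono mult_left_mono e W_le) (use \<open>w < 0\<close> \<open>0 \<le> \<tau>\<close> in auto)
  also have "\<dots> = (M\<^sup>2 / - w + 2 * M\<^sup>2 / w\<^sup>2 * c * norm P) * (norm x)\<^sup>2"
    using \<open>w < 0\<close> by (simp add: field_simps)
  finally show ?thesis .
qed

end

lemma generates_exp_stable_iff:
  "generates_exp_stable D G \<longleftrightarrow> (\<exists>S M w. w < 0 \<and> growth_semigroup S D G M w)"
proof
  assume "generates_exp_stable D G"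
  then obtain S M e where S: "C0_semigroup S" "is_generator S D G" "0 < e"
    "\<And>t. 0 \<le> t \<Longrightarrow> norm (S t) \<le> M * exp (- e * t)"
    by (auto simp: generates_exp_stable_def exp_stable_def)
  then have "growth_semigroup S D G M (- e)" by unfold_locales auto
  then show "\<exists>S M w. w < 0 \<and> growth_semigroup S D G M w" using \<open>0 < e\<close>
    by (metis neg_less_0_iff_less)
next
  assume "\<exists>S M w. w < 0 \<and> growth_semigroup S D G M w"
  then obtain S M w where "w < 0" and S: "growth_semigroup S D G M w" by blast
  interpret growth_semigroup S D G M w by fact
  \<comment> \<open>\<open>exp_stable\<close> asks for a positive constant, while \<open>M\<close>
    is only known to be nonnegative.\<close>
  have "norm (S t) \<le> (M + 1) * exp (- (- w) * t)" if "0 \<le> t" for t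
    using growth[OF that] by (simp add: distrib_right add_increasing2)
  then have "exp_stable S"
    unfolding exp_stable_def using \<open>w < 0\<close> M_nonneg
    by (intro exI[of _ "M + 1"] exI[of _ "- w"] conjI) auto
  then show "generates_exp_stable D G"
    using C0 gen by (auto simp: generates_exp_stable_def)
qed

section \<open>The Newton-Kleinman iteration\<close>

lemma adj_op_eqI:
  fixes \<phi> \<psi> :: "'x::banach \<Rightarrow>\<^sub>L real"
  assumes dense: "closure D = UNIV" and \<psi>: "\<And>x. x \<in> D \<Longrightarrow> \<phi> (G x) = \<psi> x"
  shows "adj_op D G \<phi> = \<psi>"
  unfolding adj_op_def
proof (rule the_equality)
  show "\<forall>x\<in>D. \<phi> (G x) = \<psi> x" using \<psi> by blast
  fix \<psi>' :: "'x \<Rightarrow>\<^sub>L real" assume "\<forall>x\<in>D. \<phi> (G x) = \<psi>' x"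
  then have "norm (\<psi>' - \<psi>) \<le> 0"
    using \<psi> by (intro norm_blinfun_le_dense[OF dense]) (auto simp: blinfun.diff_left)
  then show "\<psi>' = \<psi>" by simp
qed

text \<open>Testing against \<open>y\<close> in \<open>D\<close> removes the adjoint. Conversely,
  the identity exhibits \<open>y \<mapsto> P x (G y)\<close> on \<open>D\<close> as the bounded
  functional \<open>Q x - P (G x)\<close>, which puts \<open>P x\<close> into the adjoint
  domain.\<close>

lemma lyapunov_solution_iff:
  fixes P :: "'x::banach \<Rightarrow>\<^sub>L 'x \<Rightarrow>\<^sub>L real"
  assumes dense: "closure D = UNIV"
  shows "lyapunov_solution D G Q P \<longleftrightarrow> (\<forall>x\<in>D. \<forall>y\<in>D. P x (G y) + P (G x) y = Q x y)"
proof
  assume P: "lyapunov_solution D G Q P"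
  show "\<forall>x\<in>D. \<forall>y\<in>D. P x (G y) + P (G x) y = Q x y"
  proof (intro ballI)
    fix x y assume "x \<in> D" "y \<in> D"
    then obtain \<psi> :: "'x \<Rightarrow>\<^sub>L real" where \<psi>: "\<And>y. y \<in> D \<Longrightarrow> P x (G y) = \<psi> y"
      using P by (auto simp: lyapunov_solution_def maps_dom_def adj_dom_def)
    have "adj_op D G (P x) + P (G x) = Q x"
      using P \<open>x \<in> D\<close> by (simp add: lyapunov_solution_def lyap_def)
    moreover have "adj_op D G (P x) = \<psi>" by (rule adj_op_eqI[OF dense \<psi>])
    ultimately have "\<psi> + P (G x) = Q x" by simp
    then show "P x (G y) + P (G x) y = Q x y"
      using \<psi>[OF \<open>y \<in> D\<close>] by (metis blinfun.add_left)
  qed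
next
  assume P: "\<forall>x\<in>D. \<forall>y\<in>D. P x (G y) + P (G x) y = Q x y"
  have eq: "P x (G y) = (Q x - P (G x)) y" if "x \<in> D" "y \<in> D" for x y
    using P that by (simp add: blinfun.diff_left eq_diff_eq)
  then have "maps_dom D G P"
    by (auto simp: maps_dom_def adj_dom_def)
  moreover have "lyap D G P x = Q x" if "x \<in> D" for x
    using adj_op_eqI[OF dense eq[OF that]] by (simp add: lyap_def)
  ultimately show "lyapunov_solution D G Q P" by (simp add: lyapunov_solution_def)
qed

text \<open>\<open>R\<close> is the cost of the feedback \<open>F\<close>; the Riccati equation is the fixed point equation
  \<open>F = B\<^sup>*R\<close>.\<close>

definition kleinman_step ::
    "'x::banach set \<Rightarrow> ('x \<Rightarrow> 'x) \<Rightarrow> ('u::{real_inner,banach} \<Rightarrow>\<^sub>L 'x) \<Rightarrow> ('x \<Rightarrow>\<^sub>L 'v::{real_inner,banach})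
      \<Rightarrow> ('x \<Rightarrow>\<^sub>L 'u) \<Rightarrow> ('x \<Rightarrow>\<^sub>L 'x \<Rightarrow>\<^sub>L real) \<Rightarrow> bool" where
  "kleinman_step D A B C F R \<longleftrightarrow> R \<in> Bs_pos \<and>
    (\<forall>x\<in>D. \<forall>y\<in>D. R x (feedback A B F y) + R (feedback A B F x) y
      = - inner (C x) (C y) - inner (F x) (F y))"

lemma feedback_lyapunov_iff:
  assumes "closure D = UNIV"
  shows "R \<in> Bs_pos \<and> lyapunov_solution D (feedback A B K) (\<lambda>x. - adj_to C (C x) - adj_to K (K x)) R
    \<longleftrightarrow> kleinman_step D A B C K R"
  by (simp add: lyapunov_solution_iff[OF assms] kleinman_step_def adj_to_apply
      blinfun.diff_left blinfun.minus_left)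

lemma closed_loop_lyapunov_iff:
  assumes "closure D = UNIV" and Q: "Q \<in> Bs_pos"
  shows "R \<in> Bs_pos \<and> lyapunov_solution D (closed_loop A B Q)
      (\<lambda>x. - adj_to C (C x) - Q (B (adj_from B (Q x)))) R
    \<longleftrightarrow> kleinman_step D A B C (gain B Q) R"
  by (simp add: lyapunov_solution_iff[OF assms(1)] kleinman_step_def adj_to_apply
      adj_from_quadratic[OF Bs_pos_sym[OF Q]] blinfun.diff_left blinfun.minus_left
      closed_loop_eq_feedback)

lemma newton_kleinman_iff:
  assumes "closure D = UNIV" "Q 0 \<in> Bs_pos"
  shows "newton_kleinman D A B C Q \<longleftrightarrow> (\<forall>n. kleinman_step D A B C (gain B (Q n)) (Q (Suc n)))"
proof -
  \<comment> \<open>Rewriting the equation of step \<open>n\<close> uses symmetry of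
    \<open>Q n\<close>: assumed for \<open>n = 0\<close>, supplied by the preceding step
    otherwise.\<close>
  have pos: "Q n \<in> Bs_pos" if "\<And>n. Q (Suc n) \<in> Bs_pos" for n
    using assms(2) that by (cases n) auto
  have pos': "Q n \<in> Bs_pos" if "\<And>n. kleinman_step D A B C (gain B (Q n)) (Q (Suc n))" for n
    using pos that by (simp add: kleinman_step_def)
  show ?thesis
    unfolding newton_kleinman_def
    using pos pos' closed_loop_lyapunov_iff[OF assms(1), of "Q _" _ A B C] by blast
qed

lemma norm_adj_to_le: "norm (adj_to C (C x)) \<le> norm C * norm C * norm x"
proof (rule norm_blinfun_bound)
  fix y
  have "norm (adj_to C (C x) y) \<le> norm (C x) * norm (C y)"
    by (simp add: adj_to_apply Cauchy_Schwarz_ineq2)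
  also have "\<dots> \<le> (norm C * norm x) * (norm C * norm y)"
    by (intro mult_mono norm_blinfun) auto
  finally show "norm (adj_to C (C x) y) \<le> norm C * norm C * norm x * norm y" by (simp add: ac_simps)
qed simp

text \<open>Passing from \<open>A\<close> to \<open>A - BB\<^sup>*P\<close> subtracts
  \<open>PBB\<^sup>*P\<close> twice, which reverses its sign on the right-hand side. Boundedness of
  \<open>A\<^sup>*P + PA\<close> follows from the equation, whose other terms are bounded.\<close>

lemma riccati_solution_iff:
  assumes dense: "closure D = UNIV"
  shows "P \<in> Bs_pos \<and> riccati_solution D A B C P \<longleftrightarrow> kleinman_step D A B C (gain B P) P"
proof (cases "P \<in> Bs_pos")
  case True
  let ?Q = "\<lambda>x. P (B (adj_from B (P x))) - adj_to C (C x)"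
  have "norm (?Q x) \<le> (norm P * norm B * norm (gain B P) + norm C * norm C) * norm x" for x
  proof -
    have "norm (P (B (gain B P x))) \<le> norm P * (norm B * (norm (gain B P) * norm x))"
      by (meson mult_left_mono norm_blinfun norm_ge_zero order_trans)
    then show ?thesis
      using norm_triangle_ineq4[of "P (B (gain B P x))" "adj_to C (C x)"] norm_adj_to_le[of C x]
      by (simp add: gain_apply algebra_simps)
  qed
  then have bound: "\<exists>M. \<forall>x. norm (?Q x) \<le> M * norm x" by blast
  have "l - P (B (adj_from B (P x))) + adj_to C (C x) = 0 \<longleftrightarrow> l = ?Q x" for l x
    by (auto simp: algebra_simps)
  then have "riccati_solution D A B C P \<longleftrightarrow> lyapunov_solution D A ?Q P"
    unfolding riccati_solution_def lyapunov_solution_def using bound by metis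
  also have "\<dots> \<longleftrightarrow> kleinman_step D A B C (gain B P) P"
  proof -
    have "P x (B (gain B P y)) = inner (gain B P x) (gain B P y)" for x y
      by (simp add: inner_gain)
    moreover have "P (B (gain B P x)) y = inner (gain B P x) (gain B P y)" for x y
      by (metis inner_gain inner_commute Bs_pos_sym[OF True])
    ultimately show ?thesis
      unfolding lyapunov_solution_iff[OF dense] kleinman_step_def feedback_def
      using True
      by (auto simp: adj_to_apply adj_from_quadratic[OF Bs_pos_sym[OF True]] blinfun.diff_left
          blinfun.diff_right algebra_simps)
  qed
  finally show ?thesis using True by simp
qed (simp add: kleinman_step_def)

text \<open>The source of all comparisons: changing the feedback perturbs the generator by
  \<open>B (F - F')\<close>, which \<open>R\<close> sees through \<open>gain B R\<close>. Taking
  \<open>gain B R\<close> or the feedback of another step for \<open>F'\<close> produces a squared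
  difference of feedbacks.\<close>

lemma kleinman_step_diagonal:
  assumes R: "kleinman_step D A B C F R" and "y \<in> D"
  shows "R y (feedback A B F' y) + R (feedback A B F' y) y
    = - (norm (C y))\<^sup>2 - (norm (F y))\<^sup>2 + 2 * inner (gain B R y) (F y - F' y)"
proof -
  have pos: "R \<in> Bs_pos" using R by (simp add: kleinman_step_def)
  have eq: "R y (feedback A B F y) + R (feedback A B F y) y
      = - inner (C y) (C y) - inner (F y) (F y)"
    using assms by (simp add: kleinman_step_def)
  have "feedback A B F' y = feedback A B F y + B (F y - F' y)"
    by (simp add: feedback_def blinfun.diff_right)
  then have "R y (feedback A B F' y) = R y (feedback A B F y) + inner (gain B R y) (F y - F' y)"
    by (simp add: blinfun.add_right inner_gain)
  then show ?thesis
    using eq Bs_pos_sym[OF pos, of _ y] by (simp add: power2_norm_eq_inner)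
qed

lemma kleinman_step_exists:
  fixes C :: "'x::banach \<Rightarrow>\<^sub>L 'v::{real_inner,banach}"
  assumes "generates_exp_stable D (feedback A B F)"
  shows "\<exists>R. kleinman_step D A B C F R"
proof -
  obtain S M w where "w < 0" and S: "growth_semigroup S D (feedback A B F) M w"
    using assms generates_exp_stable_iff by blast
  interpret growth_semigroup S D "feedback A B F" M w by fact
  obtain qC :: "'x \<Rightarrow>\<^sub>L 'x \<Rightarrow>\<^sub>L real" where qC: "\<And>x y. qC x y = inner (C x) (C y)"
    using blinfun_of_bounded_bilinear[OF bounded_bilinear.comp[OF bounded_bilinear_inner
          blinfun.bounded_linear_right[of C] blinfun.bounded_linear_right[of C]]] by blast
  obtain qF :: "'x \<Rightarrow>\<^sub>L 'x \<Rightarrow>\<^sub>L real" where qF: "\<And>x y. qF x y = inner (F x) (F y)"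
    using blinfun_of_bounded_bilinear[OF bounded_bilinear.comp[OF bounded_bilinear_inner
          blinfun.bounded_linear_right[of F] blinfun.bounded_linear_right[of F]]] by blast
  have "qC + qF \<in> Bs_pos"
    by (simp add: Bs_pos_def blinfun.add_left qC qF inner_commute)
  then obtain R where "R \<in> Bs_pos"
    "\<forall>x\<in>D. \<forall>y\<in>D. R x (feedback A B F y) + R (feedback A B F x) y = - (qC + qF) x y"
    using lyapunov_exists[OF \<open>w < 0\<close>] by blast
  then have "kleinman_step D A B C F R"
    by (simp add: kleinman_step_def blinfun.add_left qC qF)
  then show ?thesis by blast
qed

text \<open>The constant is uniform in the feedback; this makes the constant of quadratic convergence
  independent of \<open>n\<close>.\<close>

lemma kleinman_step_stabilizing:
  fixes C :: "'x::banach \<Rightarrow>\<^sub>L 'v::{real_inner,banach}"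
  assumes "exp_detectable C D A"
  shows "\<exists>c\<ge>0. \<forall>F R. kleinman_step D A B C F R \<longrightarrow>
    (\<exists>T M w. w < 0 \<and> growth_semigroup T D (feedback A B (gain B R)) M w \<and>
      (\<forall>x\<in>D. \<forall>\<tau>\<ge>0. integral {0..\<tau>} (\<lambda>s. (norm (T s x))\<^sup>2) \<le> c * (1 + norm R) * (norm x)\<^sup>2))"
proof -
  obtain L :: "'v \<Rightarrow>\<^sub>L 'x" and S M w
    where "w < 0" and S: "growth_semigroup S D (\<lambda>x. A x - L (C x)) M w"
    using assms generates_exp_stable_iff unfolding exp_detectable_def by blast
  interpret growth_semigroup S D "\<lambda>x. A x - L (C x)" M w by fact
  define k where "k = 2 * ((norm L)\<^sup>2 + (norm B)\<^sup>2)"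
  \<comment> \<open>The constant of \<open>perturbed_L2\<close> is affine in \<open>norm R\<close>;
    with the sum of its two coefficients as \<open>c\<close> it is at most
    \<open>c * (1 + norm R)\<close>. Neither \<open>F\<close> nor \<open>R\<close> enters
    \<open>c\<close>.\<close>
  define c where "c = M\<^sup>2 / - w + 2 * M\<^sup>2 / w\<^sup>2 * k"
  have "0 \<le> k" by (simp add: k_def)
  have parts: "0 \<le> M\<^sup>2 / - w" "0 \<le> 2 * M\<^sup>2 / w\<^sup>2 * k"
    using \<open>w < 0\<close> \<open>0 \<le> k\<close> by (simp_all add: divide_nonneg_neg)
  show ?thesis
  proof (intro exI[of _ c] conjI allI impI)
    show "0 \<le> c" using parts by (simp add: c_def)
    fix F R assume R: "kleinman_step D A B C F R"
    define F' where "F' = gain B R"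
    \<comment> \<open>\<open>A - LC + H\<close> is the closed loop with feedback \<open>F'\<close>,
      and \<open>H y\<close> is controlled by the observation \<open>C y\<close> and the control
      \<open>F' y\<close>.\<close>
    define H where "H = (L o\<^sub>L C) - (B o\<^sub>L F')"
    define r where "r y = (norm (C y))\<^sup>2 + (norm (F' y))\<^sup>2" for y
    have gen_eq: "A x - L (C x) + H x = feedback A B F' x" for x
      by (simp add: H_def feedback_def blinfun.diff_left)
    obtain T l where T: "growth_semigroup T D (\<lambda>x. A x - L (C x) + H x) (2 * M) l"
      and duhamel: "\<And>t x. 0 \<le> t \<Longrightarrow> T t x = S t x + conv (\<lambda>s. H (T s x)) t"
      using bounded_perturbation[of H] by blast
    have H_le: "(norm (H y))\<^sup>2 \<le> k * r y" for y
    proof -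
      have "norm (H y) \<le> norm L * norm (C y) + norm B * norm (F' y)"
        using norm_triangle_ineq4[of "L (C y)" "B (F' y)"] norm_blinfun[of L "C y"]
          norm_blinfun[of B "F' y"] by (simp add: H_def blinfun.diff_left)
      then have "(norm (H y))\<^sup>2 \<le> (norm L * norm (C y) + norm B * norm (F' y))\<^sup>2"
        by (rule power_mono) simp
      also have "\<dots> \<le> 2 * (norm L * norm (C y))\<^sup>2 + 2 * (norm B * norm (F' y))\<^sup>2"
        using sum_squares_bound[of "norm L * norm (C y)" "norm B * norm (F' y)"]
        by (simp add: power2_sum)
      also have "\<dots> \<le> k * r y"
        by (simp add: k_def r_def power_mult_distrib algebra_simps)
      finally show ?thesis .
    qed
    have le: "R y (A y - L (C y) + H y) + R (A y - L (C y) + H y) y \<le> - r y" if "y \<in> D" for y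
    proof -
      have "R y (feedback A B F' y) + R (feedback A B F' y) y = - r y - (norm (F y - F' y))\<^sup>2"
        using kleinman_step_diagonal[OF R that, of F']
        by (simp add: r_def F'_def power2_norm_eq_inner algebra_simps inner_commute)
      then show ?thesis by (simp add: gen_eq)
    qed
    have L2: "integral {0..\<tau>} (\<lambda>s. (norm (T s x))\<^sup>2) \<le> c * (1 + norm R) * (norm x)\<^sup>2"
      if "x \<in> D" "0 \<le> \<tau>" for x \<tau>
    proof -
      have "integral {0..\<tau>} (\<lambda>s. (norm (T s x))\<^sup>2)
          \<le> (M\<^sup>2 / - w + 2 * M\<^sup>2 / w\<^sup>2 * k * norm R) * (norm x)\<^sup>2"
      proof (rule perturbed_L2[OF \<open>w < 0\<close> T duhamel _ _ \<open>0 \<le> k\<close> H_le le that])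
        show "R \<in> Bs_pos" using R by (simp add: kleinman_step_def)
        show "continuous_on UNIV r" unfolding r_def by (intro continuous_intros)
      qed
      also have "\<dots> \<le> c * (1 + norm R) * (norm x)\<^sup>2"
      proof (rule mult_right_mono)
        have "a + b * r \<le> (a + b) * (1 + r)" if "0 \<le> a" "0 \<le> b" "0 \<le> r" for a b r :: real
          using that by (simp add: algebra_simps)
        from this[OF parts norm_ge_zero]
        show "M\<^sup>2 / - w + 2 * M\<^sup>2 / w\<^sup>2 * k * norm R \<le> c * (1 + norm R)" unfolding c_def .
      qed simp
      finally show ?thesis .
    qed
    have "\<exists>M' w'. w' < 0 \<and> growth_semigroup T D (\<lambda>x. A x - L (C x) + H x) M' w'"
      by (rule growth_semigroup.datko[OF T _ L2]) (use \<open>0 \<le> c\<close> in auto)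
    then show "\<exists>T M w. w < 0 \<and> growth_semigroup T D (feedback A B (gain B R)) M w \<and>
      (\<forall>x\<in>D. \<forall>\<tau>\<ge>0. integral {0..\<tau>} (\<lambda>s. (norm (T s x))\<^sup>2) \<le> c * (1 + norm R) * (norm x)\<^sup>2)"
      using L2 unfolding gen_eq F'_def by blast
  qed
qed

section \<open>Strong limits of the iterates\<close>

lemma Bs_pos_decreasing_limit:
  fixes Q :: "nat \<Rightarrow> 'x::banach \<Rightarrow>\<^sub>L 'x \<Rightarrow>\<^sub>L real"
  assumes Q: "\<And>n. Q n \<in> Bs_pos" and dec: "\<And>n x. Q (Suc n) x x \<le> Q n x x"
  shows "\<exists>P\<in>Bs_pos. \<forall>x. (\<lambda>n. Q n x) \<longlonglongrightarrow> P x"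
proof -
  have mono: "Q n x x \<le> Q m x x" if "m \<le> n" for m n x
    using lift_Suc_antimono_le[of "\<lambda>n. Q n x x", OF dec that] .
  \<comment> \<open>In the order of forms \<open>0 \<le> Q m - Q n \<le> Q 0\<close>, so the single
    constant \<open>norm (Q 0)\<close> serves all pairs \<open>m \<le> n\<close>.\<close>
  have sq: "(norm (Q m x - Q n x))\<^sup>2 \<le> norm (Q 0) * (Q m x x - Q n x x)" if "m \<le> n" for m n x
  proof -
    have R: "Q m - Q n \<in> Bs_pos"
      using mono[OF that] op_le_iff[OF Q Q] by (simp add: op_le_def)
    have "norm (Q m - Q n) \<le> norm (Q 0)"
    proof (rule Bs_pos_norm_le[OF R])
      show "(Q m - Q n) x x \<le> norm (Q 0) * (norm x)\<^sup>2" for x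
        using mono[of 0 m x] form_le[of "Q 0" x] Bs_pos_nonneg[OF Q, of n x]
        by (simp add: blinfun.diff_left)
    qed simp
    then have "norm (Q m - Q n) * (Q m - Q n) x x \<le> norm (Q 0) * (Q m - Q n) x x"
      by (intro mult_right_mono Bs_pos_nonneg[OF R])
    then show ?thesis
      using Bs_pos_norm_apply[OF R, of x] by (simp add: blinfun.diff_left)
  qed
  have conv: "convergent (\<lambda>n. Q n x)" for x
  proof -
    have "convergent (\<lambda>n. Q n x x)"
      by (rule decseq_convergent[of "\<lambda>n. Q n x x" 0])
        (use mono Bs_pos_nonneg[OF Q] in \<open>auto simp: decseq_def convergent_def\<close>)
    then have C: "Cauchy (\<lambda>n. Q n x x)" by (rule convergent_Cauchy)
    have "Cauchy (\<lambda>n. Q n x)"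
    proof (rule metric_CauchyI)
      fix e :: real assume "0 < e"
      define k where "k = norm (Q 0) + 1"
      have "0 < k" by (simp add: k_def add_nonneg_pos)
      obtain N where N: "\<And>m n. m \<ge> N \<Longrightarrow> n \<ge> N \<Longrightarrow> dist (Q m x x) (Q n x x) < e\<^sup>2 / k"
        using metric_CauchyD[OF C, of "e\<^sup>2 / k"] \<open>0 < e\<close> \<open>0 < k\<close> by auto
      have le: "dist (Q m x) (Q n x) < e" if "N \<le> m" "m \<le> n" for m n
      proof -
        have "(norm (Q m x - Q n x))\<^sup>2 \<le> k * (Q m x x - Q n x x)"
          using sq[OF that(2), of x] mono[OF that(2), of x] by (simp add: k_def algebra_simps)
        also have "\<dots> < k * (e\<^sup>2 / k)"
          using N[of m n] that \<open>0 < k\<close> by (intro mult_strict_left_mono) (auto simp: dist_real_def)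
        also have "\<dots> = e\<^sup>2" using \<open>0 < k\<close> by simp
        finally show ?thesis using \<open>0 < e\<close> by (simp add: dist_norm power2_less_imp_less)
      qed
      show "\<exists>M. \<forall>m\<ge>M. \<forall>n\<ge>M. dist (Q m x) (Q n x) < e"
        using le by (metis dist_commute nat_le_linear)
    qed
    then show ?thesis by (rule Cauchy_convergent)
  qed
  define g where "g x = lim (\<lambda>n. Q n x)" for x
  have g: "(\<lambda>n. Q n x) \<longlonglongrightarrow> g x" for x
    using conv[of x] by (simp add: g_def convergent_LIMSEQ_iff)
  have norm_Q: "norm (Q n) \<le> norm (Q 0)" for n
    by (rule Bs_pos_norm_le[OF Q norm_ge_zero order_trans[OF mono form_le]]) simp
  have "bounded_linear g"
  proof (rule bounded_linear_intro)
    show "g (x + y) = g x + g y" for x y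
      using tendsto_add[OF g g, of x y] g[of "x + y"]
      by (auto simp: blinfun.add_right intro: LIMSEQ_unique)
    show "g (r *\<^sub>R x) = r *\<^sub>R g x" for r x
      using tendsto_scaleR[OF tendsto_const g, of r x] g[of "r *\<^sub>R x"]
      by (auto simp: blinfun.scaleR_right intro: LIMSEQ_unique)
    show "norm (g x) \<le> norm x * norm (Q 0)" for x
    proof (rule LIMSEQ_le_const2[OF tendsto_norm[OF g]])
      have "norm (Q n x) \<le> norm x * norm (Q 0)" for n
        using norm_blinfun[of "Q n" x] mult_right_mono[OF norm_Q[of n] norm_ge_zero[of x]]
        by (simp add: mult.commute)
      then show "\<exists>N. \<forall>n\<ge>N. norm (Q n x) \<le> norm x * norm (Q 0)" by blast
    qed
  qed
  then have app: "Blinfun g x = g x" for x by (simp add: bounded_linear_Blinfun_apply)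
  have gxy: "(\<lambda>n. Q n x y) \<longlonglongrightarrow> g x y" for x y
    by (rule blinfun.tendsto[OF g tendsto_const])
  have "g x y = g y x" for x y
    using gxy[of x y] gxy[of y x] Bs_pos_sym[OF Q, of _ x y] by (auto intro: LIMSEQ_unique)
  moreover have "0 \<le> g x x" for x
    by (rule LIMSEQ_le_const[OF gxy]) (use Bs_pos_nonneg[OF Q] in auto)
  ultimately have "Blinfun g \<in> Bs_pos" unfolding Bs_pos_def mem_Collect_eq app by blast
  moreover have "(\<lambda>n. Q n x) \<longlonglongrightarrow> Blinfun g x" for x unfolding app by (rule g)
  ultimately show ?thesis by blast
qed

lemma gain_tendsto:
  fixes Q :: "nat \<Rightarrow> 'x::banach \<Rightarrow>\<^sub>L 'x \<Rightarrow>\<^sub>L real" and P :: "'x \<Rightarrow>\<^sub>L 'x \<Rightarrow>\<^sub>L real"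
  assumes "(\<lambda>n. Q n x) \<longlonglongrightarrow> P x"
  shows "(\<lambda>n. gain B (Q n) x) \<longlonglongrightarrow> gain B P x"
  unfolding gain_apply by (rule bounded_linear.tendsto[OF bounded_linear_adj_from assms])

lemma kleinman_step_limit:
  fixes Q :: "nat \<Rightarrow> 'x::banach \<Rightarrow>\<^sub>L 'x \<Rightarrow>\<^sub>L real" and P :: "'x \<Rightarrow>\<^sub>L 'x \<Rightarrow>\<^sub>L real"
  assumes step: "\<And>n. kleinman_step D A B C (gain B (Q n)) (Q (Suc n))"
    and P: "P \<in> Bs_pos" and lim: "\<And>x. (\<lambda>n. Q n x) \<longlonglongrightarrow> P x"
  shows "kleinman_step D A B C (gain B P) P"
  unfolding kleinman_step_def
proof (intro conjI ballI P)
  have lim': "(\<lambda>n. Q (Suc n) x (feedback A B (gain B (Q n)) y)) \<longlonglongrightarrow> P x (feedback A B (gain B P) y)" for x y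
    unfolding feedback_def
    by (intro blinfun.tendsto LIMSEQ_Suc[OF lim] tendsto_diff tendsto_const gain_tendsto lim)
  fix x y assume xy: "x \<in> D" "y \<in> D"
  \<comment> \<open>The second term is written with the varying vector in the second slot. Only
    \<open>Q (Suc n)\<close> at fixed vectors then occurs, a norm convergent functional applied to
    convergent vectors.\<close>
  have "(\<lambda>n. Q (Suc n) x (feedback A B (gain B (Q n)) y) + Q (Suc n) y (feedback A B (gain B (Q n)) x))
      \<longlonglongrightarrow> P x (feedback A B (gain B P) y) + P y (feedback A B (gain B P) x)"
    by (intro tendsto_add lim')
  moreover have "Q (Suc n) x (feedback A B (gain B (Q n)) y) + Q (Suc n) y (feedback A B (gain B (Q n)) x)
      = - inner (C x) (C y) - inner (gain B (Q n) x) (gain B (Q n) y)" for n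
    using step[of n] xy Bs_pos_sym[of "Q (Suc n)" y] by (simp add: kleinman_step_def)
  moreover have "(\<lambda>n. - inner (C x) (C y) - inner (gain B (Q n) x) (gain B (Q n) y))
      \<longlonglongrightarrow> - inner (C x) (C y) - inner (gain B P x) (gain B P y)"
    by (intro tendsto_diff tendsto_const tendsto_inner gain_tendsto lim)
  ultimately have "P x (feedback A B (gain B P) y) + P y (feedback A B (gain B P) x)
      = - inner (C x) (C y) - inner (gain B P x) (gain B P y)"
    using LIMSEQ_unique by fastforce
  then show "P x (feedback A B (gain B P) y) + P (feedback A B (gain B P) x) y
      = - inner (C x) (C y) - inner (gain B P x) (gain B P y)"
    by (simp add: Bs_pos_sym[OF P, of y])
qed

section \<open>Comparison with a Riccati solution\<close>

lemma kleinman_step_minus_riccati: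
  assumes R: "kleinman_step D A B C F R" and P: "kleinman_step D A B C (gain B P) P" and "y \<in> D"
  shows "(R - P) y (feedback A B F y) + (R - P) (feedback A B F y) y = - (norm (F y - gain B P y))\<^sup>2"
  using kleinman_step_diagonal[OF R \<open>y \<in> D\<close>, of F] kleinman_step_diagonal[OF P \<open>y \<in> D\<close>, of F]
  by (simp add: blinfun.diff_left power2_norm_eq_inner algebra_simps inner_commute)

text \<open>Optimality of \<open>P\<close>: along the stable loop of \<open>F\<close>, the form
  \<open>R - P\<close> decreases at the rate of the squared feedback error and tends to
  zero.\<close>

lemma kleinman_step_ge_riccati:
  assumes stab: "generates_exp_stable D (feedback A B F)"
    and R: "kleinman_step D A B C F R" and P: "kleinman_step D A B C (gain B P) P"
  shows "P x x \<le> R x x"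
proof -
  obtain S M w where "w < 0" and S: "growth_semigroup S D (feedback A B F) M w"
    using stab generates_exp_stable_iff by blast
  have "0 \<le> (R - P) x x"
    by (rule growth_semigroup.stable_nonneg[OF S \<open>w < 0\<close>])
      (simp add: kleinman_step_minus_riccati[OF R P])
  then show ?thesis by (simp add: blinfun.diff_left)
qed

lemma kleinman_step_decreasing:
  assumes stab: "generates_exp_stable D (feedback A B (gain B R))"
    and R: "kleinman_step D A B C F R" and R': "kleinman_step D A B C (gain B R) R'"
  shows "R' x x \<le> R x x"
proof -
  obtain S M w where "w < 0" and S: "growth_semigroup S D (feedback A B (gain B R)) M w"
    using stab generates_exp_stable_iff by blast
  have "0 \<le> (R - R') x x"
  proof (rule growth_semigroup.stable_nonneg[OF S \<open>w < 0\<close>])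
    fix y assume "y \<in> D"
    have "(R - R') y (feedback A B (gain B R) y) + (R - R') (feedback A B (gain B R) y) y
        = - (norm (F y - gain B R y))\<^sup>2"
      using kleinman_step_diagonal[OF R \<open>y \<in> D\<close>, of "gain B R"]
        kleinman_step_diagonal[OF R' \<open>y \<in> D\<close>, of "gain B R"]
      by (simp add: blinfun.diff_left power2_norm_eq_inner algebra_simps inner_commute)
    then show "(R - R') y (feedback A B (gain B R) y) + (R - R') (feedback A B (gain B R) y) y \<le> 0"
      by simp
  qed
  then show ?thesis by (simp add: blinfun.diff_left)
qed

text \<open>The residual is the square of \<open>B\<^sup>*(Q - P)\<close>, hence quadratic in
  \<open>P - Q\<close>; integrating it along the loop of \<open>Q\<close> costs only the L2 constant
  \<open>c\<close>.\<close>

lemma kleinman_step_quadratic: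
  assumes "w < 0" and S: "growth_semigroup S D (feedback A B (gain B Q)) M w" and "0 \<le> c"
    and L2: "\<And>x \<tau>. x \<in> D \<Longrightarrow> 0 \<le> \<tau> \<Longrightarrow> integral {0..\<tau>} (\<lambda>s. (norm (S s x))\<^sup>2) \<le> c * (norm x)\<^sup>2"
    and R: "kleinman_step D A B C (gain B Q) R" and P: "kleinman_step D A B C (gain B P) P"
  shows "norm (P - R) \<le> (norm B)\<^sup>2 * c * (norm (P - Q))\<^sup>2"
proof -
  define k where "k = (norm B * norm (P - Q))\<^sup>2"
  have pos: "P \<in> Bs_pos" "R \<in> Bs_pos" using P R by (simp_all add: kleinman_step_def)
  have stab: "generates_exp_stable D (feedback A B (gain B Q))"
    using S \<open>w < 0\<close> generates_exp_stable_iff by blast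
  have RP: "R - P \<in> Bs_pos"
    using kleinman_step_ge_riccati[OF stab R P] op_le_iff[OF pos] by (simp add: op_le_def)
  have "norm (R - P) \<le> k * c"
  proof (rule Bs_pos_norm_le[OF RP])
    show "0 \<le> k * c" using \<open>0 \<le> c\<close> by (simp add: k_def)
    fix x
    \<comment> \<open>The lower bound is applied to \<open>P - R\<close>, so that it bounds the
      nonnegative form \<open>R - P\<close> from above.\<close>
    have "- (k * c) * (norm x)\<^sup>2 \<le> (P - R) x x"
    proof (rule growth_semigroup.stable_comparison[OF S \<open>w < 0\<close> _ L2])
      show "0 \<le> k" by (simp add: k_def)
      fix y assume "y \<in> D"
      have "norm (gain B (P - Q) y) \<le> norm B * norm (P - Q) * norm y"
        using norm_gain_le[of B "P - Q" y] mult_left_mono[OF norm_blinfun[of "P - Q" y], of "norm B"]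
        by (simp add: mult.assoc)
      then have "(norm (gain B (P - Q) y))\<^sup>2 \<le> (norm B * norm (P - Q) * norm y)\<^sup>2"
        by (rule power_mono) simp
      also have "\<dots> = k * (norm y)\<^sup>2" by (simp add: k_def power_mult_distrib)
      finally have "(norm (gain B Q y - gain B P y))\<^sup>2 \<le> k * (norm y)\<^sup>2"
        by (simp add: gain_diff norm_minus_commute)
      then show "(P - R) y (feedback A B (gain B Q) y) + (P - R) (feedback A B (gain B Q) y) y
          \<le> k * (norm y)\<^sup>2"
        using kleinman_step_minus_riccati[OF R P \<open>y \<in> D\<close>] by (simp add: blinfun.diff_left)
    qed
    then show "(R - P) x x \<le> k * c * (norm x)\<^sup>2" by (simp add: blinfun.diff_left)
  qed
  then show ?thesis by (simp add: k_def norm_minus_commute power_mult_distrib ac_simps)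
qed

section \<open>The iteration for a detectable pair\<close>

context
  fixes D :: "'x::banach set" and A :: "'x \<Rightarrow> 'x"
    and B :: "'u::{real_inner,banach} \<Rightarrow>\<^sub>L 'x"
    and C :: "'x \<Rightarrow>\<^sub>L 'v::{real_inner,banach}"
  assumes det: "exp_detectable C D A"
begin

lemma kleinman_step_stable:
  assumes "kleinman_step D A B C F R"
  shows "generates_exp_stable D (feedback A B (gain B R))"
  using kleinman_step_stabilizing[OF det, of B] assms generates_exp_stable_iff by blast

text \<open>Each solution is the cost of its own stabilizing feedback, so each of the two dominates
  the other.\<close>

lemma riccati_unique:
  assumes P: "kleinman_step D A B C (gain B P) P" and P': "kleinman_step D A B C (gain B P') P'"
  shows "P = P'"
proof (rule Bs_pos_eqI)
  show "P \<in> Bs_pos" "P' \<in> Bs_pos" using P P' by (simp_all add: kleinman_step_def)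
  show "P x x = P' x x" for x
    using kleinman_step_ge_riccati[OF kleinman_step_stable[OF P] P P']
      kleinman_step_ge_riccati[OF kleinman_step_stable[OF P'] P' P] by (rule antisym[rotated])
qed

lemma kleinman_sequence_exists:
  assumes "generates_exp_stable D (feedback A B (gain B P0))"
  shows "\<exists>Q. Q 0 = P0 \<and> (\<forall>n. kleinman_step D A B C (gain B (Q n)) (Q (Suc n)))"
proof -
  define next_iterate where "next_iterate R = (SOME R'. kleinman_step D A B C (gain B R) R')" for R
  have step: "kleinman_step D A B C (gain B R) (next_iterate R)"
    if "generates_exp_stable D (feedback A B (gain B R))" for R
    unfolding next_iterate_def by (rule someI_ex[OF kleinman_step_exists[OF that]])
  define Q where "Q n = (next_iterate ^^ n) P0" for n
  \<comment> \<open>A step yields a stabilizing feedback, and this makes the next Lyapunov equation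
    solvable.\<close>
  have stab: "generates_exp_stable D (feedback A B (gain B (Q n)))" for n
    using assms step kleinman_step_stable by (induction n) (auto simp: Q_def)
  have "kleinman_step D A B C (gain B (Q n)) (Q (Suc n))" for n
    using step[OF stab[of n]] by (simp add: Q_def)
  then show ?thesis by (intro exI[of _ Q]) (simp add: Q_def)
qed

context
  fixes Q :: "nat \<Rightarrow> 'x \<Rightarrow>\<^sub>L 'x \<Rightarrow>\<^sub>L real"
  assumes stab0: "generates_exp_stable D (feedback A B (gain B (Q 0)))"
    and step: "\<And>n. kleinman_step D A B C (gain B (Q n)) (Q (Suc n))"
begin

lemma kleinman_sequence_stable: "generates_exp_stable D (feedback A B (gain B (Q n)))"
  using stab0 kleinman_step_stable[OF step] by (cases n) auto

lemma kleinman_sequence_pos: "Q (Suc n) \<in> Bs_pos"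
  using step[of n] by (simp add: kleinman_step_def)

text \<open>Indices start at one: \<open>Q 0\<close> is not assumed to be the cost of a feedback, so
  nothing compares it with \<open>Q 1\<close>.\<close>

lemma kleinman_sequence_decreasing: "m \<le> n \<Longrightarrow> Q (Suc n) x x \<le> Q (Suc m) x x"
  by (rule lift_Suc_antimono_le[of "\<lambda>n. Q (Suc n) x x"])
    (rule kleinman_step_decreasing[OF kleinman_sequence_stable step step])

lemma kleinman_sequence_limit:
  "\<exists>P. kleinman_step D A B C (gain B P) P \<and> (\<forall>x. (\<lambda>n. Q n x) \<longlonglongrightarrow> P x)"
proof -
  obtain P where P: "P \<in> Bs_pos" and lim1: "\<And>x. (\<lambda>n. Q (Suc n) x) \<longlonglongrightarrow> P x"
    using Bs_pos_decreasing_limit[of "\<lambda>n. Q (Suc n)"] kleinman_sequence_pos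
      kleinman_sequence_decreasing by auto
  have lim: "(\<lambda>n. Q n x) \<longlonglongrightarrow> P x" for x
    by (rule LIMSEQ_imp_Suc) (rule lim1)
  from kleinman_step_limit[OF step P lim] lim show ?thesis by blast
qed

lemma kleinman_sequence_quadratic:
  assumes P: "kleinman_step D A B C (gain B P) P"
  shows "\<exists>\<kappa>>0. \<forall>n. norm (P - Q (Suc n)) \<le> \<kappa> * (norm (P - Q n))\<^sup>2"
proof -
  obtain c where "0 \<le> c" and c: "\<And>F R. kleinman_step D A B C F R \<Longrightarrow>
      \<exists>T M w. w < 0 \<and> growth_semigroup T D (feedback A B (gain B R)) M w \<and>
        (\<forall>x\<in>D. \<forall>\<tau>\<ge>0. integral {0..\<tau>} (\<lambda>s. (norm (T s x))\<^sup>2) \<le> c * (1 + norm R) * (norm x)\<^sup>2)"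
    using kleinman_step_stabilizing[OF det, of B] by metis
  obtain S0 M0 w0 where "w0 < 0" and S0: "growth_semigroup S0 D (feedback A B (gain B (Q 0))) M0 w0"
    using stab0 generates_exp_stable_iff by blast
  define c0 where "c0 = M0\<^sup>2 / (- 2 * w0)"
  define c1 where "c1 = c * (1 + norm (Q (Suc 0)))"
  have "0 \<le> c0" "0 \<le> c1" using \<open>w0 < 0\<close> \<open>0 \<le> c\<close> by (simp_all add: c0_def c1_def divide_nonneg_neg)
  \<comment> \<open>\<open>c0\<close> serves the loop of the initial guess; \<open>c1\<close> serves
    all later loops, because the norms of the iterates from index one on are at most that of
    \<open>Q 1\<close>. The \<open>+ 1\<close> makes \<open>\<kappa>\<close> positive.\<close>
  define \<kappa> where "\<kappa> = (norm B)\<^sup>2 * (c0 + c1) + 1"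
  have "norm (P - Q (Suc n)) \<le> \<kappa> * (norm (P - Q n))\<^sup>2" for n
  proof -
    have "\<exists>S M w. w < 0 \<and> growth_semigroup S D (feedback A B (gain B (Q n))) M w \<and>
      (\<forall>x\<in>D. \<forall>\<tau>\<ge>0. integral {0..\<tau>} (\<lambda>s. (norm (S s x))\<^sup>2) \<le> (c0 + c1) * (norm x)\<^sup>2)"
    proof (cases n)
      case 0
      have "integral {0..\<tau>} (\<lambda>s. (norm (S0 s x))\<^sup>2) \<le> (c0 + c1) * (norm x)\<^sup>2" if "0 \<le> \<tau>" for x \<tau>
        using growth_semigroup.stable_L2[OF S0 \<open>w0 < 0\<close> that, of x] mult_right_mono[of c0 "c0 + c1" "(norm x)\<^sup>2"]
          \<open>0 \<le> c1\<close> by (simp add: c0_def)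
      then show ?thesis using S0 \<open>w0 < 0\<close> 0 by blast
    next
      case (Suc m)
      have "norm (Q n) \<le> norm (Q (Suc 0))"
        unfolding Suc
        by (rule Bs_pos_norm_le[OF kleinman_sequence_pos norm_ge_zero
              order_trans[OF kleinman_sequence_decreasing form_le]]) simp
      then have "c * (1 + norm (Q n)) \<le> c0 + c1"
        using mult_left_mono[of "1 + norm (Q n)" "1 + norm (Q (Suc 0))" c] \<open>0 \<le> c\<close> \<open>0 \<le> c0\<close>
        by (simp add: c1_def)
      then have "c * (1 + norm (Q n)) * (norm x)\<^sup>2 \<le> (c0 + c1) * (norm x)\<^sup>2" for x :: 'x
        by (rule mult_right_mono) simp
      then show ?thesis using c[OF step[of m]] unfolding Suc by (meson order_trans)
    qed
    then obtain S M w where "w < 0" and S: "growth_semigroup S D (feedback A B (gain B (Q n))) M w"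
      and L2: "\<And>x \<tau>. x \<in> D \<Longrightarrow> 0 \<le> \<tau> \<Longrightarrow>
        integral {0..\<tau>} (\<lambda>s. (norm (S s x))\<^sup>2) \<le> (c0 + c1) * (norm x)\<^sup>2" by blast
    have "norm (P - Q (Suc n)) \<le> (norm B)\<^sup>2 * (c0 + c1) * (norm (P - Q n))\<^sup>2"
      by (rule kleinman_step_quadratic[OF \<open>w < 0\<close> S _ L2 step P]) (use \<open>0 \<le> c0\<close> \<open>0 \<le> c1\<close> in simp)
    then show ?thesis by (simp add: \<kappa>_def distrib_right add_increasing2)
  qed
  moreover have "0 < \<kappa>" using \<open>0 \<le> c0\<close> \<open>0 \<le> c1\<close> by (simp add: \<kappa>_def add_nonneg_pos)
  ultimately show ?thesis by blast
qed

end

text \<open>The cost \<open>P0\<close> of a stabilizing \<open>K\<close> is an admissible start,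
  since \<open>B\<^sup>*P0\<close> is again stabilizing; the solution is the limit of the
  iterates.\<close>

lemma riccati_exists:
  assumes "exp_stabilizable D A B"
  shows "\<exists>P. kleinman_step D A B C (gain B P) P"
proof -
  obtain K where "generates_exp_stable D (feedback A B K)"
    using assms by (auto simp: exp_stabilizable_def)
  then obtain P0 where "kleinman_step D A B C K P0" using kleinman_step_exists by blast
  then have stab: "generates_exp_stable D (feedback A B (gain B P0))" by (rule kleinman_step_stable)
  then obtain Q where "Q 0 = P0" "\<And>n. kleinman_step D A B C (gain B (Q n)) (Q (Suc n))"
    using kleinman_sequence_exists by blast
  then show ?thesis using kleinman_sequence_limit[of Q] stab by blast
qed

end

theorem theorem2:
  fixes D :: "'x::banach set" and A :: "'x \<Rightarrow> 'x"
    and B :: "'u::{real_inner,banach} \<Rightarrow>\<^sub>L 'x"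
    and C :: "'x \<Rightarrow>\<^sub>L 'v::{real_inner,banach}"
  assumes "generates_C0 D A"
    and "exp_stabilizable D A B"
    and "exp_detectable C D A"
  shows
    "(\<exists>!P. P \<in> Bs_pos \<and> riccati_solution D A B C P) \<and>
     (\<forall>P. P \<in> Bs_pos \<and> riccati_solution D A B C P \<longrightarrow>
        generates_exp_stable D (closed_loop A B P) \<and>
        (\<exists>P0\<in>Bs_pos. generates_exp_stable D (closed_loop A B P0)) \<and>
        (\<forall>K :: 'x \<Rightarrow>\<^sub>L 'u. generates_exp_stable D (feedback A B K) \<longrightarrow>
           (\<exists>P0\<in>Bs_pos. lyapunov_solution D (feedback A B K)
                           (\<lambda>x. - adj_to C (C x) - adj_to K (K x)) P0) \<and>
           (\<forall>P0\<in>Bs_pos. lyapunov_solution D (feedback A B K)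
                           (\<lambda>x. - adj_to C (C x) - adj_to K (K x)) P0 \<longrightarrow>
              generates_exp_stable D (closed_loop A B P0))) \<and>
        (\<forall>P0\<in>Bs_pos. generates_exp_stable D (closed_loop A B P0) \<longrightarrow>
           (\<exists>Q. Q 0 = P0 \<and> newton_kleinman D A B C Q) \<and>
           (\<forall>Q. Q 0 = P0 \<and> newton_kleinman D A B C Q \<longrightarrow>
              (monotone_on {1..} (\<le>) op_le Q \<or> monotone_on {1..} (\<le>) (\<lambda>R S. op_le S R) Q) \<and>
              (\<forall>x. (\<lambda>n. Q n x) \<longlonglongrightarrow> P x) \<and>
              (\<exists>\<kappa>>0. \<forall>n. norm (P - Q (Suc n)) \<le> \<kappa> * (norm (P - Q n))\<^sup>2))))"
proof -
  note det = assms(3)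
  note stable = kleinman_step_stable[OF det, folded closed_loop_eq_feedback]
  \<comment> \<open>Detectability makes \<open>D\<close> the domain of the generator
    \<open>A - LC\<close> as well, and its semigroup comes with a growth bound; hence
    \<open>D\<close> is dense.\<close>
  obtain L :: "'v \<Rightarrow>\<^sub>L 'x" and S M w where "growth_semigroup S D (\<lambda>x. A x - L (C x)) M w"
    using det generates_exp_stable_iff unfolding exp_detectable_def by blast
  then have dense: "closure D = UNIV" by (rule growth_semigroup.dense_domain)
  note ric = riccati_solution_iff[OF dense]
  have "\<exists>!P. P \<in> Bs_pos \<and> riccati_solution D A B C P"
    unfolding ric using riccati_exists[OF det assms(2)] riccati_unique[OF det] by blast
  moreover have "generates_exp_stable D (closed_loop A B P)"
    if "P \<in> Bs_pos \<and> riccati_solution D A B C P" for P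
    using that stable unfolding ric by blast
  moreover have "\<exists>P0\<in>Bs_pos. lyapunov_solution D (feedback A B K)
      (\<lambda>x. - adj_to C (C x) - adj_to K (K x)) P0"
    if "generates_exp_stable D (feedback A B K)" for K :: "'x \<Rightarrow>\<^sub>L 'u"
    using kleinman_step_exists[OF that, of C, folded feedback_lyapunov_iff[OF dense]] by blast
  moreover have "generates_exp_stable D (closed_loop A B P0)"
    if "P0 \<in> Bs_pos" "lyapunov_solution D (feedback A B K) (\<lambda>x. - adj_to C (C x) - adj_to K (K x)) P0"
    for K :: "'x \<Rightarrow>\<^sub>L 'u" and P0
    using stable feedback_lyapunov_iff[OF dense, of P0 A B K C] that by blast
  moreover have "\<exists>Q. Q 0 = P0 \<and> newton_kleinman D A B C Q"
    if "P0 \<in> Bs_pos" "generates_exp_stable D (closed_loop A B P0)" for P0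
    using kleinman_sequence_exists[OF det, of B P0] that newton_kleinman_iff[OF dense]
    unfolding closed_loop_eq_feedback by metis
  moreover have "monotone_on {1..} (\<le>) (\<lambda>R S. op_le S R) Q \<and> (\<forall>x. (\<lambda>n. Q n x) \<longlonglongrightarrow> P x) \<and>
      (\<exists>\<kappa>>0. \<forall>n. norm (P - Q (Suc n)) \<le> \<kappa> * (norm (P - Q n))\<^sup>2)"
    if P: "P \<in> Bs_pos \<and> riccati_solution D A B C P" and "Q 0 \<in> Bs_pos"
      and stab0: "generates_exp_stable D (closed_loop A B (Q 0))"
      and "newton_kleinman D A B C Q" for P Q
  proof (intro conjI)
    have step: "kleinman_step D A B C (gain B (Q n)) (Q (Suc n))" for n
      using that newton_kleinman_iff[OF dense] by blast
    note seq = det stab0[unfolded closed_loop_eq_feedback] step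
    have P': "kleinman_step D A B C (gain B P) P" using P unfolding ric .
    show "\<exists>\<kappa>>0. \<forall>n. norm (P - Q (Suc n)) \<le> \<kappa> * (norm (P - Q n))\<^sup>2"
      by (rule kleinman_sequence_quadratic[OF seq P'])
    \<comment> \<open>The limit of the iterates also solves the Riccati equation, and uniqueness
      identifies it with the given \<open>P\<close>.\<close>
    show "\<forall>x. (\<lambda>n. Q n x) \<longlonglongrightarrow> P x"
      using kleinman_sequence_limit[OF seq] riccati_unique[OF det P'] by blast
    show "monotone_on {1..} (\<le>) (\<lambda>R S. op_le S R) Q"
    proof (rule monotone_onI)
      fix m n :: nat assume "m \<in> {1..}" "n \<in> {1..}" "m \<le> n"
      then obtain i j where "m = Suc i" "n = Suc j" "i \<le> j"
        by (metis Suc_le_D Suc_le_mono atLeast_iff One_nat_def)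
      then show "op_le (Q n) (Q m)"
        using kleinman_sequence_pos[OF seq] kleinman_sequence_decreasing[OF seq]
        by (simp add: op_le_iff)
    qed
  qed
  ultimately show ?thesis by blast
qed

end
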